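(* Let $G$ be a finite group, and let $L(G)$ be its subgroup graph. Then $L(G)$ is a regular graph if and only if $G$ is cyclic and the order of $G$ is square-free.
   Context: The subgroup graph $L(G)$ of a finite group $G$ is the (undirected, simple) graph whose vertices are all subgroups of $G$, where two vertices $H_1$ and $H_2$ are joined by an edge if and only if one of them, say $H_1$, satisfies $H_1 < H_2$ and there is no subgroup $K$ of $G$ with $H_1 < K < H_2$ (i.e. $H_1$ is a maximal subgroup of $H_2$). A graph is regular if all its vertices have the same degree. *)

theory Defs
  imports "HOL-Algebra.Algebra" "HOL-Computational_Algebra.Squarefree"
begin

definition subgroups_of :: "('a, 'b) monoid_scheme \<Rightarrow> 'a set set" where
  "subgroups_of G = {H. subgroup H G}"

definition covered_by :: "('a, 'b) monoid_scheme \<Rightarrow> 'a set \<Rightarrow> 'a set \<Rightarrow> bool" where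
  "covered_by G H1 H2 \<longleftrightarrow> subgroup H1 G \<and> subgroup H2 G \<and> H1 \<subset> H2 \<and>
     \<not> (\<exists>K. subgroup K G \<and> H1 \<subset> K \<and> K \<subset> H2)"

definition subgroup_graph_adj :: "('a, 'b) monoid_scheme \<Rightarrow> 'a set \<Rightarrow> 'a set \<Rightarrow> bool" where
  "subgroup_graph_adj G H1 H2 \<longleftrightarrow> covered_by G H1 H2 \<or> covered_by G H2 H1"

definition subgroup_graph_degree :: "('a, 'b) monoid_scheme \<Rightarrow> 'a set \<Rightarrow> nat" where
  "subgroup_graph_degree G H = card {K \<in> subgroups_of G. subgroup_graph_adj G H K}"

definition subgroup_graph_regular :: "('a, 'b) monoid_scheme \<Rightarrow> bool" where
  "subgroup_graph_regular G \<longleftrightarrow>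
     (\<forall>H1 \<in> subgroups_of G. \<forall>H2 \<in> subgroups_of G.
        subgroup_graph_degree G H1 = subgroup_graph_degree G H2)"

end

theory Submission
  imports Defs "HOL-Number_Theory.Residues"
begin

text \<open>
  Let \<open>d\<close> be the degree of the trivial subgroup, that is, the number of subgroups of prime order.
  A cyclic subgroup \<open>H\<close> of prime power order has at most one lower neighbour, so in a regular graph it has
  at least \<open>d - 1\<close> covers, and distinct covers meet in \<open>H\<close>. If every cover of \<open>H\<close> contains a subgroup of
  prime order outside \<open>H\<close>, then by counting each cover contains exactly one such \<open>Q\<close>, and every \<open>Q\<close>
  other than the prime order subgroup \<open>P\<close> of \<open>H\<close> occurs. A group with exactly two subgroups \<open>P\<close>, \<open>Q\<close> of
  prime order forces them to commute and to have different orders; call \<open>P\<close> isolated if this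
  happens for all \<open>Q\<close>.

  If \<open>G\<close> has no element of order \<open>p\<^sup>2\<close>, this applies with \<open>H = P\<close>. If \<open>p\<close> is odd and there is such an
  element, it applies with \<open>H\<close> a cyclic \<open>p\<close>-subgroup of maximal order, because a noncyclic \<open>p\<close>-group with a
  cyclic maximal subgroup has a second subgroup of order \<open>p\<close>; but then the \<open>d - 1\<close> products \<open>PQ\<close> and a cyclic
  group of order \<open>p\<^sup>2\<close> are \<open>d\<close> covers of \<open>P\<close>, a contradiction. If there is an element of order \<open>4\<close>, let
  \<open>Z\<close> be generated by its square. As all odd primes are harmless, comparing the covers of \<open>Z\<close> with \<open>d - 1\<close>
  shows that the subgroups of order \<open>4\<close> above \<open>Z\<close> are as many as the involutions outside \<open>Z\<close>; the former
  number is odd, the latter even. Hence all subgroups of prime order are isolated and no element has order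
  \<open>p\<^sup>2\<close>, which makes \<open>G\<close> cyclic of square-free order.
\<close>

hide_const (open) Divisibility.prime

section \<open>Subgroups of prime order and covers\<close>

locale finite_group = group +
  assumes fin: "finite (carrier G)"
begin

definition prime_subgroups :: "'a set \<Rightarrow> 'a set set" where
  "prime_subgroups K = {P. subgroup P G \<and> P \<subseteq> K \<and> prime (card P)}"

definition covers :: "'a set \<Rightarrow> 'a set set" where
  "covers H = {K. covered_by G H K}"

lemma finite_subgroup: "subgroup H G \<Longrightarrow> finite H"
  using fin subgroup.subset finite_subset by metis

lemma finite_prime_subgroups: "finite (prime_subgroups (carrier G))"
  by (rule finite_subset[of _ "Pow (carrier G)"]) (auto simp: prime_subgroups_def fin)

lemma finite_covers: "finite (covers H)"
  by (rule finite_subset[of _ "Pow (carrier G)"])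
    (auto simp: covers_def covered_by_def fin dest: subgroup.subset)

lemma subgroup_generate: "x \<in> carrier G \<Longrightarrow> subgroup (generate G {x}) G"
  by (simp add: generate_is_subgroup)

lemma generate_self: "x \<in> generate G {x}"
  by (simp add: generate.incl)

lemma generate_le: "subgroup H G \<Longrightarrow> x \<in> H \<Longrightarrow> generate G {x} \<subseteq> H"
  by (simp add: generate_subgroup_incl)

lemma card_generate: "x \<in> carrier G \<Longrightarrow> card (generate G {x}) = ord x"
  by (simp add: generate_pow_card)

lemma ord_pos: "x \<in> carrier G \<Longrightarrow> 0 < ord x"
  using ord_ge_1[OF fin] by fastforce

lemma subgroup_pow_closed: "subgroup H G \<Longrightarrow> x \<in> H \<Longrightarrow> x [^] (n::nat) \<in> H"
  using subgroup_int_pow_closed[of H x "int n"] by (simp add: int_pow_int)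

lemma generateE:
  assumes "y \<in> generate G {x}" "x \<in> carrier G"
  obtains k :: nat where "y = x [^] k"
  using assms generate_pow_on_finite_carrier[OF fin] by auto

section \<open>Lagrange, Cauchy and subgroups of prime order\<close>

lemma card_subgroup_dvd:
  assumes "subgroup H G" "subgroup K G" "H \<subseteq> K"
  shows "card H dvd card K"
proof -
  interpret K: group "G\<lparr>carrier := K\<rparr>" by (rule subgroup_imp_group[OF assms(2)])
  have "subgroup H (G\<lparr>carrier := K\<rparr>)"
    using assms subgroup_incl by blast
  from K.lagrange[OF this] have "card K = card (rcosets\<^bsub>G\<lparr>carrier := K\<rparr>\<^esub> H) * card H"
    by (simp add: order_def)
  then show ?thesis by simp
qed

lemma subgroup_card_eq:
  assumes "subgroup H G" "subgroup K G" "H \<subseteq> K" "card H = card K"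
  shows "H = K"
  using assms card_subset_eq finite_subgroup by blast

lemma ord_dvd_card: "subgroup H G \<Longrightarrow> x \<in> H \<Longrightarrow> ord x dvd card H"
  using card_subgroup_dvd[of "generate G {x}" H] generate_le[of H x] card_generate[of x]
    subgroup_generate[of x] subgroup.mem_carrier[of H G x] by simp

text \<open>Cauchy's theorem inside \<open>K\<close>: \<open>sylow_thm\<close> with exponent 1 in
  the group carried by \<open>K\<close>, the result being lifted back to \<open>G\<close>.\<close>

lemma exists_prime_subgroup:
  assumes "subgroup K G" "p dvd card K" "prime p"
  obtains P where "P \<in> prime_subgroups K" "card P = p"
proof -
  interpret K: group "G\<lparr>carrier := K\<rparr>" by (rule subgroup_imp_group[OF assms(1)])
  obtain m where "card K = p ^ 1 * m" using assms(2) by auto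
  then have "order (G\<lparr>carrier := K\<rparr>) = p ^ 1 * m" by (simp add: order_def)
  then obtain P where P: "subgroup P (G\<lparr>carrier := K\<rparr>)" "card P = p ^ 1"
    using sylow_thm[OF assms(3) K.is_group] finite_subgroup[OF assms(1)] by fastforce
  then have "subgroup P G" "P \<subseteq> K"
    using incl_subgroup[OF assms(1)] subgroup.subset[OF P(1)] by auto
  with P(2) assms(3) show thesis by (intro that[of P]) (auto simp: prime_subgroups_def)
qed

lemma prime_subgroupsD:
  assumes "P \<in> prime_subgroups K"
  shows "subgroup P G" "P \<subseteq> K" "prime (card P)" "P \<subseteq> carrier G"
  using assms subgroup.subset unfolding prime_subgroups_def by auto

lemma prime_subgroup_generate:
  assumes "P \<in> prime_subgroups K" "x \<in> P" "x \<noteq> \<one>"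
  shows "generate G {x} = P" "ord x = card P"
proof -
  note P = prime_subgroupsD(1,3)[OF assms(1)]
  have x: "x \<in> carrier G" using prime_subgroupsD(4)[OF assms(1)] assms(2) by auto
  have "ord x \<noteq> 1" using assms(3) ord_eq_1[OF x] by simp
  then show o: "ord x = card P"
    using ord_dvd_card[OF P(1) assms(2)] P(2) prime_nat_iff by metis
  show "generate G {x} = P"
    using subgroup_card_eq[OF subgroup_generate[OF x] P(1) generate_le[OF P(1) assms(2)]]
    by (simp add: card_generate[OF x] o)
qed

lemma prime_subgroup_obtain:
  assumes "P \<in> prime_subgroups K"
  obtains x where "x \<in> carrier G" "x \<in> P" "x \<noteq> \<one>" "generate G {x} = P" "ord x = card P"
proof -
  note P = prime_subgroupsD(1,3)[OF assms(1)]
  have "P \<noteq> {\<one>}" using P(2) by auto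
  then obtain x where "x \<in> P" "x \<noteq> \<one>"
    using subgroup.one_closed[OF P(1)] by auto
  then show thesis
    using that[of x] prime_subgroup_generate[OF assms] subgroup.mem_carrier[OF P(1)] by auto
qed

text \<open>A common nontrivial element generates both groups. Hence distinct subgroups of prime
  order meet trivially.\<close>

lemma prime_subgroup_eqI:
  assumes "P \<in> prime_subgroups K" "Q \<in> prime_subgroups L" "x \<in> P" "x \<in> Q" "x \<noteq> \<one>"
  shows "P = Q"
  using prime_subgroup_generate(1)[OF assms(1,3,5)] prime_subgroup_generate(1)[OF assms(2,4,5)] by simp

lemma prime_subgroup_subset_eq:
  assumes "P \<in> prime_subgroups K" "Q \<in> prime_subgroups L" "P \<subseteq> Q"
  shows "P = Q"
  using prime_subgroup_obtain[OF assms(1)] prime_subgroup_eqI[OF assms(1,2)] assms(3) by blast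

lemma generate_prime_subgroup:
  assumes "subgroup K G" "x \<in> K" "prime (ord x)"
  shows "generate G {x} \<in> prime_subgroups K"
  using assms subgroup_generate card_generate generate_le subgroup.mem_carrier[OF assms(1,2)]
  unfolding prime_subgroups_def by auto

lemma pow_ord_div:
  assumes "x \<in> carrier G" "m dvd ord x"
  shows "ord (x [^] (ord x div m)) = m"
proof -
  have "ord x div m dvd ord x" "ord x div m \<noteq> 0"
    using assms ord_pos[OF assms(1)] by (auto simp: dvd_div_eq_0_iff)
  then have "ord (x [^] (ord x div m)) = ord x div (ord x div m)"
    using ord_pow[OF assms(1)] by blast
  then show ?thesis
    using assms ord_pos[OF assms(1)] by auto
qed

section \<open>Covers and vertex degrees\<close>

text \<open>By Lagrange the index of \<open>H\<close> in an intermediate \<open>L\<close> divides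
  \<open>p\<close>, so \<open>L\<close> is one of the two ends.\<close>

lemma covered_by_prime_index:
  assumes "subgroup H G" "subgroup K G" "H \<subseteq> K" "card K = card H * p" "prime p"
  shows "covered_by G H K"
proof -
  have pos: "0 < card H" using subgroup.finite_imp_card_positive[OF assms(1) fin] .
  have "H \<noteq> K" using assms(4,5) pos by (auto dest: prime_gt_1_nat)
  moreover have False if L: "subgroup L G" "H \<subset> L" "L \<subset> K" for L
  proof -
    obtain a where a: "card L = card H * a"
      using card_subgroup_dvd[OF assms(1) L(1)] L(2) by auto
    have "card L dvd card K" using card_subgroup_dvd[OF L(1) assms(2)] L(3) by auto
    then have "a dvd p" using a assms(4) pos by simp
    then have "a = 1 \<or> a = p" using assms(5) by (simp add: prime_nat_iff)
    then have "card L = card H \<or> card L = card K" using a assms(4) by auto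
    moreover have "H \<subseteq> L" "L \<subseteq> K" using L(2,3) by auto
    ultimately have "H = L \<or> L = K"
      using subgroup_card_eq[OF assms(1) L(1)] subgroup_card_eq[OF L(1) assms(2)] by metis
    then show False using L(2,3) by auto
  qed
  ultimately show ?thesis using assms unfolding covered_by_def by blast
qed

lemma covered_by_trivial_iff: "covered_by G {\<one>} K \<longleftrightarrow> K \<in> prime_subgroups (carrier G)"
proof
  assume K: "covered_by G {\<one>} K"
  then have sK: "subgroup K G" "{\<one>} \<subset> K" unfolding covered_by_def by auto
  then have "card K \<noteq> 1" by (auto simp: card_1_singleton_iff)
  then obtain p where "prime p" "p dvd card K" using prime_factor_nat by blast
  then obtain P where P: "P \<in> prime_subgroups K" using exists_prime_subgroup[OF sK(1)] by blast
  obtain x where "x \<in> P" "x \<noteq> \<one>" using prime_subgroup_obtain[OF P] by blast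
  moreover note PD = prime_subgroupsD[OF P]
  ultimately have "{\<one>} \<subset> P" using subgroup.one_closed[OF PD(1)] by auto
  then have "P = K" using K PD(1,2) unfolding covered_by_def by blast
  then show "K \<in> prime_subgroups (carrier G)"
    using P PD(4) unfolding prime_subgroups_def by auto
next
  assume K: "K \<in> prime_subgroups (carrier G)"
  then show "covered_by G {\<one>} K"
    using covered_by_prime_index[OF triv_subgroup, of K "card K"] subgroup.one_closed
    unfolding prime_subgroups_def by auto
qed

lemma degree_eq:
  "subgroup_graph_degree G H = card (covers H) + card {K. covered_by G K H}"
proof -
  have "{K \<in> subgroups_of G. subgroup_graph_adj G H K} = covers H \<union> {K. covered_by G K H}"
    unfolding subgroups_of_def subgroup_graph_adj_def covers_def covered_by_def by auto
  moreover have "covers H \<inter> {K. covered_by G K H} = {}"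
    unfolding covers_def covered_by_def by auto
  moreover have "finite {K. covered_by G K H}"
    by (rule finite_subset[of _ "Pow (carrier G)"])
      (auto simp: covered_by_def fin dest: subgroup.subset)
  ultimately show ?thesis
    unfolding subgroup_graph_degree_def by (simp add: card_Un_disjoint finite_covers)
qed

lemma degree_trivial: "subgroup_graph_degree G {\<one>} = card (prime_subgroups (carrier G))"
proof -
  have "{K. covered_by G K {\<one>}} = {}"
    unfolding covered_by_def by (auto dest: subgroup.one_closed)
  moreover have "covers {\<one>} = prime_subgroups (carrier G)"
    unfolding covers_def using covered_by_trivial_iff by auto
  ultimately show ?thesis by (simp add: degree_eq)
qed

text \<open>The intersection is a subgroup between \<open>H\<close> and each of the two covers; were
  it larger than \<open>H\<close>, it would be equal to both.\<close>

lemma covers_Int: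
  assumes "K \<in> covers H" "L \<in> covers H" "K \<noteq> L"
  shows "K \<inter> L = H"
proof -
  have K: "covered_by G H K" and L: "covered_by G H L" using assms unfolding covers_def by auto
  have s: "subgroup (K \<inter> L) G" using K L unfolding covered_by_def by (simp add: subgroups_Inter_pair)
  have "H \<subseteq> K \<inter> L" using K L unfolding covered_by_def by auto
  moreover have "\<not> H \<subset> K \<inter> L"
  proof
    assume *: "H \<subset> K \<inter> L"
    then have "K \<inter> L = K" "K \<inter> L = L" using s K L unfolding covered_by_def by blast+
    then show False using assms(3) by blast
  qed
  ultimately show ?thesis by blast
qed

lemma pow_eq_pow_iff_cong:
  assumes "x \<in> carrier G"
  shows "x [^] (m::nat) = x [^] (n::nat) \<longleftrightarrow> [m = n] (mod ord x)"
proof -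
  have "x [^] m = x [^] n \<longleftrightarrow> int (ord x) dvd int n - int m"
    using int_pow_eq[OF assms, of "int m" "int n"] by (simp add: int_pow_int)
  also have "\<dots> \<longleftrightarrow> [int n = int m] (mod int (ord x))" by (simp add: cong_iff_dvd_diff)
  finally show ?thesis by (simp add: cong_int_iff cong_sym_eq)
qed

text \<open>An inverse of \<open>k\<close> modulo \<open>ord x\<close> is an exponent that recovers
  \<open>x\<close> from \<open>x [^] k\<close>.\<close>

lemma pow_in_generate_coprime:
  assumes "x \<in> carrier G" "coprime k (ord x)"
  shows "x \<in> generate G {x [^] k}"
proof -
  obtain s where s: "[k * s = 1] (mod ord x)" using cong_solve_coprime_nat[OF assms(2)] by auto
  then have "x [^] (k * s) = x [^] (1::nat)"
    using pow_eq_pow_iff_cong[OF assms(1)] by blast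
  then have "x = (x [^] k) [^] s" using assms(1) by (simp add: nat_pow_pow)
  moreover have "(x [^] k) [^] s \<in> generate G {x [^] k}"
    using subgroup_pow_closed[OF subgroup_generate generate_self] assms(1) by blast
  ultimately show ?thesis by simp
qed

text \<open>A power \<open>c [^] k\<close> with \<open>k\<close> prime to \<open>p\<close> generates
  the whole group again, so every proper subgroup lies in the one generated by
  \<open>c [^] p\<close>. The bound turns equality of degrees into a lower bound for the number of
  covers.\<close>

lemma card_lower_prime_power:
  assumes "c \<in> carrier G" "ord c = p ^ i" "prime p"
  shows "card {L. covered_by G L (generate G {c})} \<le> 1"
proof (cases "i = 0")
  case True
  then have "generate G {c} = {\<one>}" using assms ord_eq_1[of c] generate_one by simp
  then have "{L. covered_by G L (generate G {c})} = {}"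
    unfolding covered_by_def by (auto dest: subgroup.one_closed)
  then show ?thesis by simp
next
  case False
  let ?C = "generate G {c}" and ?D = "generate G {c [^] p}"
  have p: "p dvd ord c" "p \<noteq> 0" using False assms by (auto simp: prime_gt_0_nat)
  have sD: "subgroup ?D G" "subgroup ?C G" using assms subgroup_generate by auto
  have "c [^] p \<in> ?C" using subgroup_pow_closed[OF sD(2) generate_self] .
  then have DC: "?D \<subseteq> ?C" using generate_le[OF sD(2)] by blast
  have "card ?D = ord c div p" using ord_pow[OF assms(1) p] assms(1) card_generate by simp
  moreover have "ord c div p < ord c"
    using ord_pos[OF assms(1)] prime_gt_1_nat[OF assms(3)] by simp
  ultimately have "?D \<noteq> ?C" using card_generate[OF assms(1)] by auto
  then have DC': "?D \<subset> ?C" using DC by blast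
  have "L = ?D" if L: "covered_by G L ?C" for L
  proof -
    have sL: "subgroup L G" "L \<subset> ?C" using L unfolding covered_by_def by auto
    have "L \<subseteq> ?D"
    proof
      fix y assume y: "y \<in> L"
      then obtain k :: nat where k: "y = c [^] k" using generateE[OF _ assms(1)] sL by blast
      have "p dvd k"
      proof (rule ccontr)
        assume "\<not> p dvd k"
        then have "coprime k (ord c)"
          using prime_imp_coprime[OF assms(3)] by (simp add: assms(2) coprime_commute)
        then have "c \<in> generate G {y}" using pow_in_generate_coprime[OF assms(1)] k by blast
        then have "c \<in> L" using generate_le[OF sL(1) y] by blast
        then show False using generate_le[OF sL(1)] sL(2) by blast
      qed
      then obtain j where "k = p * j" by auto
      then have "y = (c [^] p) [^] j" using k assms(1) by (simp add: nat_pow_pow)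
      then show "y \<in> ?D" using subgroup_pow_closed[OF sD(1) generate_self] by simp
    qed
    then show ?thesis using L DC' sD unfolding covered_by_def by blast
  qed
  then have "{L. covered_by G L ?C} \<subseteq> {?D}" by blast
  then show ?thesis using card_mono[of "{?D}"] by simp
qed

lemma covered_by_prime_subgroup:
  assumes "P \<in> prime_subgroups K"
  shows "{L. covered_by G L P} = {{\<one>}}"
proof -
  have P: "P \<in> prime_subgroups (carrier G)"
    using assms prime_subgroupsD(4)[OF assms] unfolding prime_subgroups_def by auto
  then have 1: "covered_by G {\<one>} P" by (simp add: covered_by_trivial_iff)
  have "L = {\<one>}" if "covered_by G L P" for L
    using that 1 triv_subgroup subgroup.one_closed[of L G] unfolding covered_by_def by blast
  then show ?thesis using 1 by blast
qed

end

section \<open>Isolated subgroups of prime order\<close>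

lemma prime_power_if_unique_prime_divisor:
  fixes n p :: nat
  assumes "0 < n" "\<And>q. prime q \<Longrightarrow> q dvd n \<Longrightarrow> q = p"
  shows "\<exists>k. n = p ^ k"
proof -
  have "prime_factors n \<subseteq> {p}" using assms(2) by (auto simp: prime_factors_dvd)
  then have "prime_factors n = {} \<or> prime_factors n = {p}" by blast
  moreover have "n = (\<Prod>q\<in>prime_factors n. q ^ multiplicity q n)"
    using prime_factorization_nat[OF assms(1)] .
  ultimately have "n = p ^ 0 \<or> n = p ^ multiplicity p n" by auto
  then show ?thesis by blast
qed

context finite_group
begin

text \<open>If \<open>r = w [^] k\<close> lies in \<open>R\<close>, then
  \<open>r [^] card R = \<one>\<close> makes \<open>ord w div card R\<close> divide
  \<open>k\<close>; comparing sizes finishes. The right side depends on \<open>R\<close> only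
  through \<open>card R\<close>, so subgroups of equal size in a cyclic group coincide.\<close>

lemma subgroup_of_cyclic:
  assumes "w \<in> carrier G" "subgroup R G" "R \<subseteq> generate G {w}"
  shows "R = generate G {w [^] (ord w div card R)}"
proof -
  let ?m = "ord w div card R"
  have dvd: "card R dvd ord w"
    using card_subgroup_dvd[OF assms(2) subgroup_generate[OF assms(1)] assms(3)]
    by (simp add: card_generate assms(1))
  have s: "subgroup (generate G {w [^] ?m}) G" by (simp add: subgroup_generate assms(1))
  have "R \<subseteq> generate G {w [^] ?m}"
  proof
    fix r assume r: "r \<in> R"
    then obtain k :: nat where k: "r = w [^] k" using generateE[OF _ assms(1)] assms(3) by blast
    have rc: "r \<in> carrier G" using k assms(1) by simp
    have "r [^] card R = \<one>" using ord_dvd_card[OF assms(2) r] pow_eq_id[OF rc] by blast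
    then have "ord w dvd k * card R" using k assms(1) pow_eq_id by (simp add: nat_pow_pow)
    then have "?m dvd k" using dvd
      by (metis div_dvd_iff_mult dvd_0_left_iff mult_is_0 not_less0 ord_pos[OF assms(1)])
    then obtain j where "k = ?m * j" by auto
    then have "r = (w [^] ?m) [^] j" using k assms(1) by (simp add: nat_pow_pow)
    then show "r \<in> generate G {w [^] ?m}" using subgroup_pow_closed[OF s generate_self] by simp
  qed
  moreover have "card (generate G {w [^] ?m}) = card R"
    using pow_ord_div[OF assms(1) dvd] card_generate assms(1) by simp
  ultimately show ?thesis using subgroup_card_eq[OF assms(2) s] by simp
qed

section \<open>Conjugation and pairs of subgroups of prime order\<close>

lemma inv_mult_cancel [simp]:
  assumes "x \<in> carrier G" "y \<in> carrier G"
  shows "inv x \<otimes> (x \<otimes> y) = y" "x \<otimes> (inv x \<otimes> y) = y"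
  using assms by (simp_all flip: m_assoc)

lemma conj_pow:
  assumes "k \<in> carrier G" "x \<in> carrier G"
  shows "(k \<otimes> x \<otimes> inv k) [^] (n::nat) = k \<otimes> x [^] n \<otimes> inv k"
proof (induction n)
  case 0
  then show ?case using assms by simp
next
  case (Suc n)
  then show ?case using Suc assms by (simp add: m_assoc)
qed

lemma ord_conj:
  assumes "k \<in> carrier G" "x \<in> carrier G"
  shows "ord (k \<otimes> x \<otimes> inv k) = ord x"
proof -
  have "(k \<otimes> y \<otimes> inv k = \<one>) \<longleftrightarrow> y = \<one>" if "y \<in> carrier G" for y
    using assms(1) that by (metis inv_closed inv_equality inv_inv l_cancel_one m_closed r_inv r_one)
  then have "(k \<otimes> x \<otimes> inv k) [^] n = \<one> \<longleftrightarrow> ord x dvd n" for n :: nat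
    using assms by (simp add: conj_pow pow_eq_id)
  then show ?thesis using ord_unique[of "k \<otimes> x \<otimes> inv k" "ord x"] assms by simp
qed

text \<open>For nontrivial \<open>x\<close> the conjugate has the same prime order and lies in
  \<open>K\<close>, hence in \<open>P\<close> or \<open>Q\<close>. From \<open>Q\<close> it could be
  conjugated back by \<open>y\<close>, which would put \<open>x\<close> into
  \<open>Q\<close>.\<close>

lemma conj_two_prime_subgroups:
  assumes "subgroup K G" "prime_subgroups K = {P, Q}" "P \<noteq> Q" "x \<in> P" "y \<in> Q"
  shows "y \<otimes> x \<otimes> inv y \<in> P"
proof (cases "x = \<one>")
  case True
  have P: "P \<in> prime_subgroups K" and Q: "Q \<in> prime_subgroups K" using assms(2) by auto
  have "y \<in> carrier G" using prime_subgroupsD(4)[OF Q] assms(5) by auto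
  then show ?thesis using True subgroup.one_closed[OF prime_subgroupsD(1)[OF P]] by simp
next
  case False
  have P: "P \<in> prime_subgroups K" and Q: "Q \<in> prime_subgroups K" using assms(2) by auto
  have x: "x \<in> carrier G" "x \<in> K" using prime_subgroupsD(2,4)[OF P] assms(4) by auto
  have y: "y \<in> carrier G" "y \<in> K" using prime_subgroupsD(2,4)[OF Q] assms(5) by auto
  let ?z = "y \<otimes> x \<otimes> inv y"
  have zK: "?z \<in> K"
    using assms(1) x y by (simp add: subgroup.m_closed subgroup.m_inv_closed)
  have "prime (ord ?z)"
    using ord_conj x y prime_subgroup_generate(2)[OF P assms(4) False] prime_subgroupsD(3)[OF P] by simp
  then have "generate G {?z} \<in> {P, Q}" using generate_prime_subgroup[OF assms(1) zK] assms(2) by simp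
  then have "?z \<in> P \<or> ?z \<in> Q" using generate_self[of ?z] by auto
  moreover have False if z: "?z \<in> Q"
  proof -
    have sQ: "subgroup Q G" by (rule prime_subgroupsD(1)[OF Q])
    have "inv y \<otimes> ?z \<otimes> y \<in> Q"
      using z assms(5) sQ by (simp add: subgroup.m_closed subgroup.m_inv_closed)
    moreover have "inv y \<otimes> ?z \<otimes> y = x"
      using x y by (simp add: m_assoc)
    ultimately show False using prime_subgroup_eqI[OF P Q assms(4) _ False] assms(3) by simp
  qed
  ultimately show ?thesis by blast
qed

text \<open>The two subgroups normalise each other, so their commutators lie in the trivial intersection;
  if the orders agreed, a product of generators would generate a third subgroup of that order.\<close>

lemma two_prime_subgroups:
  assumes "subgroup K G" "prime_subgroups K = {P, Q}" "P \<noteq> Q"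
  shows "\<forall>x\<in>P. \<forall>y\<in>Q. x \<otimes> y = y \<otimes> x" and "card P \<noteq> card Q"
proof -
  have P: "P \<in> prime_subgroups K" and Q: "Q \<in> prime_subgroups K" using assms(2) by auto
  note sP = prime_subgroupsD(1)[OF P] and sQ = prime_subgroupsD(1)[OF Q]
  have int: "z = \<one>" if "z \<in> P" "z \<in> Q" for z
    using prime_subgroup_eqI[OF P Q that] assms(3) by blast
  show comm: "\<forall>x\<in>P. \<forall>y\<in>Q. x \<otimes> y = y \<otimes> x"
  proof (intro ballI)
    fix x y assume x: "x \<in> P" and y: "y \<in> Q"
    have xc: "x \<in> carrier G" and yc: "y \<in> carrier G"
      using prime_subgroupsD(4)[OF P] prime_subgroupsD(4)[OF Q] x y by auto
    have "prime_subgroups K = {Q, P}" using assms(2) by auto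
    then have "x \<otimes> y \<otimes> inv x \<in> Q"
      using conj_two_prime_subgroups[OF assms(1) _ assms(3)[symmetric] y x] by blast
    then have 1: "x \<otimes> y \<otimes> inv x \<otimes> inv y \<in> Q"
      using y sQ by (simp add: subgroup.m_closed subgroup.m_inv_closed)
    have "y \<otimes> inv x \<otimes> inv y \<in> P"
      using conj_two_prime_subgroups[OF assms(1,2,3) subgroup.m_inv_closed[OF sP x] y] .
    then have "x \<otimes> (y \<otimes> inv x \<otimes> inv y) \<in> P" using x sP by (simp add: subgroup.m_closed)
    then have "x \<otimes> y \<otimes> inv x \<otimes> inv y \<in> P" using xc yc by (simp add: m_assoc)
    then have "x \<otimes> y \<otimes> inv x \<otimes> inv y = \<one>" using 1 int by blast
    then have "x \<otimes> y \<otimes> inv x = y" using xc yc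
      by (metis inv_closed inv_inv inv_equality m_closed)
    then show "x \<otimes> y = y \<otimes> x" using xc yc by (metis inv_solve_right m_closed)
  qed
  show "card P \<noteq> card Q"
  proof
    assume eq: "card P = card Q"
    obtain x where x: "x \<in> carrier G" "x \<in> P" "x \<noteq> \<one>" "ord x = card P"
      using prime_subgroup_obtain[OF P] by blast
    obtain y where y: "y \<in> carrier G" "y \<in> Q" "y \<noteq> \<one>" "ord y = card Q"
      using prime_subgroup_obtain[OF Q] by blast
    let ?w = "x \<otimes> y"
    have w: "?w \<in> K" "?w \<in> carrier G"
      using prime_subgroupsD(2)[OF P] prime_subgroupsD(2)[OF Q] x y assms(1)
      by (auto intro: subgroup.m_closed)
    have nQ: "?w \<notin> Q"
    proof
      assume "?w \<in> Q"
      then have "?w \<otimes> inv y \<in> Q" using y sQ by (simp add: subgroup.m_closed subgroup.m_inv_closed)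
      then have "x \<in> Q" using x y by (simp add: m_assoc)
      then show False using int x by blast
    qed
    have nP: "?w \<notin> P"
    proof
      assume "?w \<in> P"
      then have "inv x \<otimes> ?w \<in> P" using x sP by (simp add: subgroup.m_closed subgroup.m_inv_closed)
      then have "y \<in> P" using x y by (simp flip: m_assoc)
      then show False using int y by blast
    qed
    have "?w [^] card P = x [^] card P \<otimes> y [^] card P"
      using pow_mult_distrib[of x y "card P"] comm x y by blast
    also have "\<dots> = \<one>" using x y eq by (metis pow_ord_eq_1 r_one one_closed)
    finally have "ord ?w dvd card P" using pow_eq_id w by blast
    moreover have "ord ?w \<noteq> 1" using ord_eq_1[OF w(2)] nP subgroup.one_closed[OF sP] by auto
    ultimately have "prime (ord ?w)"
      using prime_subgroupsD(3)[OF P] prime_nat_iff by metis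
    then have "generate G {?w} \<in> {P, Q}" using generate_prime_subgroup[OF assms(1) w(1)] assms(2) by simp
    then show False using nP nQ generate_self[of ?w] by auto
  qed
qed

text \<open>The product \<open>?w\<close> of commuting generators has order
  \<open>card P * card Q\<close>; the cover is the cyclic group it generates, in which a subgroup is
  determined by its order.\<close>

lemma join_commuting_prime_subgroups:
  assumes "P \<in> prime_subgroups (carrier G)" "Q \<in> prime_subgroups (carrier G)"
    and "card P \<noteq> card Q" and comm: "\<forall>x\<in>P. \<forall>y\<in>Q. x \<otimes> y = y \<otimes> x"
  shows "\<exists>K. covered_by G P K \<and> prime_subgroups K = {P, Q}"
proof -
  note sP = prime_subgroupsD[OF assms(1)] and sQ = prime_subgroupsD[OF assms(2)]
  obtain x where x: "x \<in> carrier G" "x \<in> P" "generate G {x} = P" "ord x = card P"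
    using prime_subgroup_obtain[OF assms(1)] by blast
  obtain y where y: "y \<in> carrier G" "y \<in> Q" "generate G {y} = Q" "ord y = card Q"
    using prime_subgroup_obtain[OF assms(2)] by blast
  let ?w = "x \<otimes> y"
  let ?K = "generate G {?w}"
  have xy: "x \<otimes> y = y \<otimes> x" using comm x y by blast
  have cop: "coprime (card P) (card Q)" using sP(3) sQ(3) assms(3) by (simp add: primes_coprime)
  have w: "?w \<in> carrier G" using x y by simp
  have sK: "subgroup ?K G" by (rule subgroup_generate[OF w])
  \<comment> \<open>This power removes the factor \<open>y\<close>, and what remains of
    \<open>x\<close> still generates \<open>P\<close> by coprimality.\<close>
  have "?w [^] card Q = x [^] card Q"
    using pow_mult_distrib[OF xy x(1) y(1), of "card Q"] x(1) pow_ord_eq_1[OF y(1)] y(4) by simp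
  then have "x [^] card Q \<in> ?K" using subgroup_pow_closed[OF sK generate_self, of "card Q"] by simp
  moreover have "x \<in> generate G {x [^] card Q}"
    using pow_in_generate_coprime[OF x(1)] cop x(4) by (simp add: coprime_commute)
  ultimately have "x \<in> ?K" using generate_le[OF sK] by blast
  then have PK: "P \<subseteq> ?K" using generate_le[OF sK] x(3) by blast
  have "?w [^] card P = y [^] card P"
    using pow_mult_distrib[OF xy x(1) y(1), of "card P"] y(1) pow_ord_eq_1[OF x(1)] x(4) by simp
  then have "y [^] card P \<in> ?K" using subgroup_pow_closed[OF sK generate_self, of "card P"] by simp
  moreover have "y \<in> generate G {y [^] card P}"
    using pow_in_generate_coprime[OF y(1)] cop y(4) by simp
  ultimately have "y \<in> ?K" using generate_le[OF sK] by blast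
  then have QK: "Q \<subseteq> ?K" using generate_le[OF sK] y(3) by blast
  have "card P dvd card ?K" "card Q dvd card ?K"
    using card_subgroup_dvd sP(1) sQ(1) sK PK QK by blast+
  then have "card P * card Q dvd card ?K" using cop by (simp add: divides_mult)
  moreover have "card ?K dvd card P * card Q"
    using ord_mul_divides[OF xy x(1) y(1)] x(4) y(4) card_generate[OF w] by simp
  ultimately have cK: "card ?K = card P * card Q" using dvd_antisym by blast
  have "covered_by G P ?K" by (rule covered_by_prime_index[OF sP(1) sK PK cK sQ(3)])
  moreover have "R = P \<or> R = Q" if R: "R \<in> prime_subgroups ?K" for R
  proof -
    note sR = prime_subgroupsD[OF R]
    have "card R dvd card P * card Q" using card_subgroup_dvd[OF sR(1) sK sR(2)] cK by simp
    then have "card R dvd card P \<or> card R dvd card Q" using prime_dvd_multD[OF sR(3)] by blast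
    then have "card R = card P \<or> card R = card Q"
      using primes_dvd_imp_eq sP(3) sQ(3) sR(3) by blast
    then show ?thesis
      using subgroup_of_cyclic[OF w sR(1,2)] subgroup_of_cyclic[OF w sP(1) PK]
        subgroup_of_cyclic[OF w sQ(1) QK] by metis
  qed
  moreover have "P \<in> prime_subgroups ?K" "Q \<in> prime_subgroups ?K"
    using sP sQ PK QK unfolding prime_subgroups_def by auto
  ultimately show ?thesis by blast
qed

section \<open>Counting covers\<close>

text \<open>A pigeonhole argument: choose in each cover of \<open>H\<close> a subgroup of prime
  order other than \<open>P\<close>. Distinct covers meet in \<open>H\<close>, so the choice is
  injective, and \<open>many\<close> makes it a bijection onto all candidates different from
  \<open>P\<close>.\<close>

lemma covers_with_two_prime_subgroups:
  assumes H: "prime_subgroups H = {P}"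
    and many: "card (prime_subgroups (carrier G)) \<le> card (covers H) + 1"
    and new: "\<And>K. K \<in> covers H \<Longrightarrow> prime_subgroups K \<noteq> {P}"
    and Q: "Q \<in> prime_subgroups (carrier G)" "Q \<noteq> P"
  shows "\<exists>K \<in> covers H. prime_subgroups K = {P, Q}"
proof -
  let ?M = "prime_subgroups (carrier G)"
  have mono: "prime_subgroups H \<subseteq> prime_subgroups K" if "K \<in> covers H" for K
    using that unfolding covers_def covered_by_def prime_subgroups_def by auto
  have PM: "P \<in> ?M" using H prime_subgroupsD[of P H] unfolding prime_subgroups_def by auto
  have "\<exists>R. R \<in> prime_subgroups K \<and> R \<noteq> P" if "K \<in> covers H" for K
    using mono[OF that] new[OF that] H by auto
  then obtain f where f: "\<And>K. K \<in> covers H \<Longrightarrow> f K \<in> prime_subgroups K \<and> f K \<noteq> P"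
    by metis
  have same: "K = L" if "K \<in> covers H" "L \<in> covers H" "R \<in> prime_subgroups K"
    "R \<in> prime_subgroups L" "R \<noteq> P" for K L R
  proof (rule ccontr)
    assume "K \<noteq> L"
    then have "K \<inter> L = H" using covers_Int that by blast
    then have "R \<in> prime_subgroups H"
      using that(3,4) unfolding prime_subgroups_def by auto
    then show False using H that(5) by simp
  qed
  have inj: "inj_on f (covers H)"
    by (rule inj_onI) (metis f same)
  have sub: "f ` covers H \<subseteq> ?M - {P}"
  proof
    fix R assume "R \<in> f ` covers H"
    then obtain K where "K \<in> covers H" "R = f K" by auto
    then have R: "R \<in> prime_subgroups K" "R \<noteq> P" using f by auto
    then show "R \<in> ?M - {P}" using prime_subgroupsD[OF R(1)] unfolding prime_subgroups_def by simp
  qed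
  have "card (?M - {P}) \<le> card (f ` covers H)"
    using many PM by (simp add: card_image[OF inj] finite_prime_subgroups)
  then have surj: "f ` covers H = ?M - {P}"
    by (intro card_seteq) (use sub finite_prime_subgroups in auto)
  then obtain K where K: "K \<in> covers H" "f K = Q" using Q by (metis Diff_iff imageE singletonD)
  \<comment> \<open>A third subgroup \<open>R\<close> would be the chosen one of some cover
    \<open>L\<close>; since \<open>R\<close> lies in both \<open>K\<close> and \<open>L\<close>,
    these covers coincide, and \<open>R\<close> is \<open>f K = Q\<close> after all.\<close>
  have "R = P \<or> R = Q" if R: "R \<in> prime_subgroups K" for R
  proof (rule ccontr)
    assume *: "\<not> (R = P \<or> R = Q)"
    have "R \<in> ?M - {P}" using R * prime_subgroupsD[OF R] unfolding prime_subgroups_def by auto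
    then obtain L where L: "L \<in> covers H" "f L = R" using surj by (metis imageE)
    then have "L = K" using same[OF L(1) K(1), of R] f[OF L(1)] R * by blast
    then show False using L K * by simp
  qed
  moreover have "P \<in> prime_subgroups K" "Q \<in> prime_subgroups K"
    using mono[OF K(1)] H f[OF K(1)] K(2) by auto
  ultimately show ?thesis using K(1) by blast
qed

definition isolated :: "'a set \<Rightarrow> bool" where
  "isolated P \<longleftrightarrow> (\<forall>Q \<in> prime_subgroups (carrier G) - {P}.
     card Q \<noteq> card P \<and> (\<forall>x\<in>P. \<forall>y\<in>Q. x \<otimes> y = y \<otimes> x))"

text \<open>Some cover of \<open>H\<close> contains just \<open>P\<close> and \<open>Q\<close>, and
  \<open>two_prime_subgroups\<close> applies inside it. \<open>H\<close> is kept general: it is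
  \<open>P\<close> itself in one use and a cyclic \<open>p\<close>-subgroup of maximal order in the
  other.\<close>

lemma isolatedI:
  assumes "prime_subgroups H = {P}"
    and "card (prime_subgroups (carrier G)) \<le> card (covers H) + 1"
    and "\<And>K. K \<in> covers H \<Longrightarrow> prime_subgroups K \<noteq> {P}"
  shows "isolated P"
  unfolding isolated_def
proof
  fix Q assume Q: "Q \<in> prime_subgroups (carrier G) - {P}"
  then obtain K where K: "K \<in> covers H" "prime_subgroups K = {P, Q}"
    using covers_with_two_prime_subgroups[OF assms, of Q] by blast
  have sK: "subgroup K G" using K(1) unfolding covers_def covered_by_def by auto
  have "P \<noteq> Q" using Q by auto
  from two_prime_subgroups[OF sK K(2) this]
  show "card Q \<noteq> card P \<and> (\<forall>x\<in>P. \<forall>y\<in>Q. x \<otimes> y = y \<otimes> x)" by auto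
qed

lemma card_covers_prime:
  assumes "subgroup_graph_regular G" "P \<in> prime_subgroups (carrier G)"
  shows "card (prime_subgroups (carrier G)) = card (covers P) + 1"
proof -
  have "subgroup_graph_degree G {\<one>} = subgroup_graph_degree G P"
    using assms triv_subgroup prime_subgroupsD(1)[OF assms(2)]
    unfolding subgroup_graph_regular_def subgroups_of_def by blast
  then show ?thesis
    unfolding degree_trivial unfolding degree_eq covered_by_prime_subgroup[OF assms(2)] by simp
qed

text \<open>Joining \<open>P\<close> with each other subgroup of prime order already gives as many
  covers as regularity permits; the cyclic group generated by \<open>x\<close> would be one
  more.\<close>

lemma isolated_no_prime_square:
  assumes "subgroup_graph_regular G" "P \<in> prime_subgroups (carrier G)" "isolated P"
    and x: "x \<in> carrier G" "ord x = card P * card P"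
  shows False
proof -
  let ?M = "prime_subgroups (carrier G)"
  note P = prime_subgroupsD[OF assms(2)]
  have "\<exists>K. covered_by G P K \<and> prime_subgroups K = {P, Q}" if Q: "Q \<in> ?M - {P}" for Q
  proof -
    have "card P \<noteq> card Q" "\<forall>x\<in>P. \<forall>y\<in>Q. x \<otimes> y = y \<otimes> x"
      using bspec[OF assms(3)[unfolded isolated_def] Q] by auto
    then show ?thesis using Q join_commuting_prime_subgroups[OF assms(2)] by blast
  qed
  then obtain f where f: "\<And>Q. Q \<in> ?M - {P} \<Longrightarrow> covered_by G P (f Q) \<and> prime_subgroups (f Q) = {P, Q}"
    by metis
  have inj: "inj_on f (?M - {P})"
  proof (rule inj_onI)
    fix Q R assume *: "Q \<in> ?M - {P}" "R \<in> ?M - {P}" "f Q = f R"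
    then have "{P, Q} = {P, R}" using f[OF *(1)] f[OF *(2)] by simp
    then show "Q = R" using * by (metis Diff_iff doubleton_eq_iff insertI1)
  qed
  let ?L = "generate G {x}"
  have sL: "subgroup ?L G" "card ?L = card P * card P"
    using x subgroup_generate card_generate by auto
  obtain S where S: "S \<in> prime_subgroups ?L" "card S = card P"
    using exists_prime_subgroup[OF sL(1) _ P(3)] sL(2) by auto
  have "S \<in> ?M" using prime_subgroupsD[OF S(1)] unfolding prime_subgroups_def by auto
  then have "S = P" using assms(3) S(2) unfolding isolated_def by auto
  then have PL: "P \<subseteq> ?L" using prime_subgroupsD(2)[OF S(1)] by simp
  have L: "?L \<in> covers P"
    unfolding covers_def using covered_by_prime_index[OF P(1) sL(1) PL sL(2) P(3)] by simp
  \<comment> \<open>Every subgroup of prime order in \<open>?L\<close> has order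
    \<open>card P\<close>, whereas \<open>f Q\<close> contains \<open>Q\<close> of a different
    order.\<close>
  have "?L \<noteq> f Q" if Q: "Q \<in> ?M - {P}" for Q
  proof
    assume "?L = f Q"
    then have "Q \<in> prime_subgroups ?L" using f[OF Q] by simp
    note D = prime_subgroupsD[OF this]
    have "card Q dvd card P * card P" using card_subgroup_dvd[OF D(1) sL(1) D(2)] sL(2) by simp
    then have "card Q dvd card P" using prime_dvd_multD[OF D(3)] by blast
    then have "card Q = card P" using primes_dvd_imp_eq D(3) P(3) by blast
    then show False using Q assms(3) unfolding isolated_def by auto
  qed
  then have nin: "?L \<notin> f ` (?M - {P})" by blast
  have sub: "insert ?L (f ` (?M - {P})) \<subseteq> covers P"
    using f L unfolding covers_def by auto
  have fin': "finite (f ` (?M - {P}))" using finite_prime_subgroups by simp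
  have "card (insert ?L (f ` (?M - {P}))) = card (?M - {P}) + 1"
    using nin fin' by (simp add: card_image[OF inj])
  also have "card (?M - {P}) + 1 = card ?M"
    using assms(2) finite_prime_subgroups by (metis Suc_eq_plus1 card_Suc_Diff1)
  finally have "card ?M \<le> card (covers P)" using card_mono[OF finite_covers sub] by simp
  then show False using card_covers_prime[OF assms(1,2)] by simp
qed

lemma prime_subgroups_prime:
  assumes "P \<in> prime_subgroups K"
  shows "prime_subgroups P = {P}"
  using assms prime_subgroup_subset_eq[OF _ assms] unfolding prime_subgroups_def by blast

lemma unique_prime_subgroup_ord:
  assumes "subgroup K G" "\<And>R. R \<in> prime_subgroups K \<Longrightarrow> card R = p" "x \<in> K" "prime p"
  shows "\<exists>n. ord x = p ^ n"
proof -
  have x: "x \<in> carrier G" using assms(1,3) subgroup.mem_carrier by metis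
  have "q = p" if q: "prime q" "q dvd ord x" for q
  proof -
    have "q dvd card K" using q(2) ord_dvd_card[OF assms(1,3)] by (rule dvd_trans)
    then show ?thesis using exists_prime_subgroup[OF assms(1) _ q(1)] assms(2) by metis
  qed
  then show ?thesis using prime_power_if_unique_prime_divisor ord_pos[OF x] by blast
qed

text \<open>The counting is applied with \<open>H = P\<close>. In a cover whose only subgroup of
  prime order is \<open>P\<close>, all orders are powers of \<open>card P\<close>; an element
  outside \<open>P\<close> has exponent at least 2, and a power of it has the excluded
  order.\<close>

lemma isolated_if_no_prime_square:
  assumes "subgroup_graph_regular G" "P \<in> prime_subgroups (carrier G)"
    and no: "\<And>x. x \<in> carrier G \<Longrightarrow> ord x \<noteq> card P * card P"
  shows "isolated P"
proof (rule isolatedI)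
  note P = prime_subgroupsD[OF assms(2)]
  show "prime_subgroups P = {P}" by (rule prime_subgroups_prime[OF assms(2)])
  show "card (prime_subgroups (carrier G)) \<le> card (covers P) + 1"
    using card_covers_prime[OF assms(1,2)] by simp
  fix K assume K: "K \<in> covers P"
  then have sK: "subgroup K G" "P \<subset> K" unfolding covers_def covered_by_def by auto
  show "prime_subgroups K \<noteq> {P}"
  proof
    assume u: "prime_subgroups K = {P}"
    obtain x where x: "x \<in> K" "x \<notin> P" using sK by auto
    then have xc: "x \<in> carrier G" using subgroup.mem_carrier[OF sK(1)] by simp
    obtain n where n: "ord x = card P ^ n"
      using unique_prime_subgroup_ord[OF sK(1) _ x(1) P(3)] u by auto
    have "x \<noteq> \<one>" using x(2) subgroup.one_closed[OF P(1)] by auto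
    then have "n \<noteq> 0" using n ord_eq_1[OF xc] by (metis power_0)
    moreover have "n \<noteq> 1"
    proof
      assume "n = 1"
      then have "generate G {x} \<in> prime_subgroups K"
        using n P(3) generate_prime_subgroup[OF sK(1) x(1)] by simp
      then show False using u generate_self[of x] x(2) by auto
    qed
    ultimately have "2 \<le> n" by simp
    then have "card P * card P dvd ord x"
      using n le_imp_power_dvd[of 2 n "card P"] by (simp add: power2_eq_square)
    then show False using pow_ord_div[OF xc] no xc by blast
  qed
qed

end

section \<open>Odd primes\<close>

text \<open>Orbit sizes are powers of \<open>p\<close>, so an orbit that is not a fixed point
  contributes a multiple of \<open>p\<close>. With \<open>x0\<close> as the only fixed point,
  \<open>card E\<close> would be 1 modulo \<open>p\<close>.\<close>

lemma (in group_action) p_group_second_fixed_point: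
  assumes "order G = p ^ n" "prime p" "finite E" "p dvd card E"
    and x0: "x0 \<in> E" "\<forall>g\<in>carrier G. \<phi> g x0 = x0"
  shows "\<exists>x\<in>E. x \<noteq> x0 \<and> (\<forall>g\<in>carrier G. \<phi> g x = x)"
proof (rule ccontr)
  assume none: "\<not> ?thesis"
  let ?O = "orbits G E \<phi>"
  have one: "\<one> \<in> carrier G" using group.is_monoid group_hom group_hom.axioms(1) monoid.one_closed by metis
  have orb0: "orbit G \<phi> x0 = {x0}"
    unfolding orbit_def using x0(2) one by force
  have in_O: "{x0} \<in> ?O" unfolding orbits_def using orb0 x0 by force
  have cov: "\<Union> ?O = E" by (rule orbits_coverture)
  have finO: "finite ?O" using cov assms(3) finite_UnionD by metis
  have "p dvd card A" if A: "A \<in> ?O - {{x0}}" for A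
  proof -
    obtain x where x: "x \<in> E" "A = orbit G \<phi> x" using A unfolding orbits_def by auto
    have "card A dvd p ^ n"
      using orbit_stabilizer_theorem[OF x(1)] x(2) assms(1) by (metis dvd_triv_left)
    then obtain i where i: "card A = p ^ i" using divides_primepow_nat[OF assms(2)] by blast
    have "i \<noteq> 0"
    proof
      assume "i = 0"
      then have "card A = 1" using i by simp
      moreover have xA: "x \<in> A" using orbit_refl[OF x(1)] x(2) by simp
      ultimately have A1: "A = {x}" by (metis card_1_singletonE singletonD)
      then have "\<forall>g\<in>carrier G. \<phi> g x = x" using x(2) unfolding orbit_def by auto
      then have "x = x0" using none x(1) by blast
      then show False using A A1 by simp
    qed
    then show ?thesis using i by simp
  qed
  then have "p dvd (\<Sum>A\<in>?O - {{x0}}. card A)" by (rule dvd_sum)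
  moreover have "card E = card {x0} + (\<Sum>A\<in>?O - {{x0}}. card A)"
  proof -
    have "card E = (\<Sum>A\<in>?O. \<Sum>x\<in>A. 1)" using disjoint_sum[OF assms(3), of "\<lambda>_. 1::nat"] by simp
    also have "\<dots> = (\<Sum>A\<in>?O. card A)" by simp
    also have "\<dots> = card {x0} + (\<Sum>A\<in>?O - {{x0}}. card A)" by (rule sum.remove[OF finO in_O])
    finally show ?thesis .
  qed
  ultimately have "p dvd 1" using assms(4) by (metis dvd_add_left_iff card.empty card.insert finite.emptyI empty_iff One_nat_def)
  then show False using assms(2) by auto
qed

text \<open>With \<open>t = 1 + p * u\<close>, the power \<open>t ^ j\<close> is
  \<open>1 + j * (p * u)\<close> modulo \<open>p ^ 2\<close>, so the sum is \<open>p\<close> modulo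
  \<open>p ^ 2\<close>.\<close>

lemma geometric_sum_prime:
  fixes t p :: nat
  assumes "prime p" "odd p" "[t = 1] (mod p)"
  shows "\<exists>v. (\<Sum>j<p. t ^ j) = p * v \<and> coprime v p"
proof -
  have p1: "1 < p" using prime_gt_1_nat[OF assms(1)] .
  have "t mod p = 1" using assms(3) p1 by (simp add: cong_def)
  then obtain u where u: "t = 1 + p * u" by (metis mod_mult_div_eq)
  have pw: "[t ^ j = 1 + j * (p * u)] (mod p ^ 2)" for j
  proof (induction j)
    case (Suc j)
    have "[t ^ Suc j = t * (1 + j * (p * u))] (mod p ^ 2)"
      unfolding power_Suc using Suc by (rule cong_scalar_left)
    also have "t * (1 + j * (p * u)) = (1 + Suc j * (p * u)) + p ^ 2 * (j * u * u)"
      unfolding u by (simp add: algebra_simps power2_eq_square)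
    also have "[\<dots> = 1 + Suc j * (p * u)] (mod p ^ 2)"
      by (simp add: cong_def)
    finally show ?case .
  qed simp
  have "[(\<Sum>j<p. t ^ j) = (\<Sum>j<p. 1 + j * (p * u))] (mod p ^ 2)"
    by (rule cong_sum) (rule pw)
  also have "(\<Sum>j<p. 1 + j * (p * u)) = p + (\<Sum>j<p. j) * (p * u)"
    by (simp only: sum.distrib sum_distrib_right) simp
  \<comment> \<open>Oddness enters here: \<open>p\<close> divides the sum of the exponents, so the
    linear term vanishes modulo \<open>p ^ 2\<close>.\<close>
  also have "(\<Sum>j<p. j) = p * ((p - 1) div 2)"
  proof -
    have "(\<Sum>j<p. j) = p * (p - 1) div 2"
      using Sum_Ico_nat[of 0 p] by (simp add: atLeast0LessThan)
    then show ?thesis using assms(2) by (metis div_mult_swap even_diff_nat odd_one odd_even_add)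
  qed
  also have "p + p * ((p - 1) div 2) * (p * u) = p + p ^ 2 * ((p - 1) div 2 * u)"
    by (simp add: power2_eq_square algebra_simps)
  also have "[\<dots> = p] (mod p ^ 2)" by (simp add: cong_def)
  finally have "(\<Sum>j<p. t ^ j) mod p ^ 2 = p"
    using p1 by (simp add: cong_def power2_eq_square)
  then obtain w where w: "(\<Sum>j<p. t ^ j) = p + p ^ 2 * w" by (metis mod_mult_div_eq)
  have "coprime (1 + p * w) p"
    by (rule coprimeI) (metis dvd_add_left_iff dvd_mult2)
  moreover have "(\<Sum>j<p. t ^ j) = p * (1 + p * w)"
    using w by (simp add: power2_eq_square algebra_simps)
  ultimately show ?thesis by blast
qed

context finite_group
begin

section \<open>Normalizers in finite p-groups\<close>

text \<open>Right multiplication of cosets becomes a left action through \<open>inv h\<close>; the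
  function is restricted to \<open>E\<close> because members of \<open>BijGroup E\<close> are
  extensional.\<close>

lemma coset_action:
  assumes sH: "subgroup H G" and sK: "subgroup K G" and HK: "H \<subseteq> K"
  defines "E \<equiv> (\<lambda>x. H #> x) ` K"
  shows "group_action (G\<lparr>carrier := H\<rparr>) E (\<lambda>h. \<lambda>R\<in>E. R #> inv h)"
proof -
  let ?\<phi> = "\<lambda>h. \<lambda>R\<in>E. R #> inv h"
  have Hc: "H \<subseteq> carrier G" and Kc: "K \<subseteq> carrier G" using sH sK subgroup.subset by auto
  have ER: "R \<subseteq> carrier G" if "R \<in> E" for R
  proof -
    obtain x where "x \<in> K" "R = H #> x" using \<open>R \<in> E\<close> unfolding E_def by auto
    then show ?thesis using r_coset_subset_G[OF Hc, of x] Kc by auto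
  qed
  have cl: "R #> k \<in> E" if R: "R \<in> E" and k: "k \<in> K" for R k
  proof -
    obtain x where x: "x \<in> K" "R = H #> x" using R unfolding E_def by auto
    have "R #> k = H #> (x \<otimes> k)" using x k Hc coset_mult_assoc[of H x k] subsetD[OF Kc] by simp
    then show ?thesis using subgroup.m_closed[OF sK x(1) k] unfolding E_def by auto
  qed
  have inv1: "(R #> k) #> inv k = R" "(R #> inv k) #> k = R" if "R \<in> E" "k \<in> K" for R k
    using ER[OF that(1)] subsetD[OF Kc that(2)] by (simp_all add: coset_mult_assoc)
  have Hk: "h \<in> K" "inv h \<in> K" "h \<in> carrier G" if "h \<in> H" for h
    using that HK Hc subgroup.m_inv_closed[OF sK] by auto
  have bij: "?\<phi> h \<in> Bij E" if h: "h \<in> H" for h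
  proof -
    have "bij_betw (\<lambda>R. R #> inv h) E E"
      by (rule bij_betw_byWitness[where f' = "\<lambda>R. R #> h"])
        (use inv1 cl Hk[OF h] in auto)
    then have "bij_betw (?\<phi> h) E E" by (subst bij_betw_cong[where g = "\<lambda>R. R #> inv h"]) auto
    then show ?thesis unfolding Bij_def by auto
  qed
  have hom: "?\<phi> (g \<otimes> h) = compose E (?\<phi> g) (?\<phi> h)" if g: "g \<in> H" and h: "h \<in> H" for g h
  proof
    fix R
    show "?\<phi> (g \<otimes> h) R = compose E (?\<phi> g) (?\<phi> h) R"
    proof (cases "R \<in> E")
      case True
      have "R #> inv h #> inv g = R #> (inv h \<otimes> inv g)"
        using ER[OF True] Hk[OF g] Hk[OF h] by (simp add: coset_mult_assoc)
      then show ?thesis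
        using True cl[OF True Hk(2)[OF h]] Hk(3)[OF g] Hk(3)[OF h]
        by (simp add: compose_def inv_mult_group)
    qed (simp add: compose_def)
  qed
  have "?\<phi> \<in> hom (G\<lparr>carrier := H\<rparr>) (BijGroup E)"
    unfolding hom_def BijGroup_def using bij hom by (auto simp: Pi_iff)
  then show ?thesis
    unfolding group_action_def group_hom_def group_hom_axioms_def
    using subgroup_imp_group[OF sH] group_BijGroup by auto
qed

text \<open>\<open>H\<close> acts on its right cosets in \<open>K\<close>, whose number is a power
  of \<open>p\<close> other than 1, and fixes the coset \<open>H\<close>. A second fixed coset
  \<open>H #> x\<close> gives an \<open>x\<close> that conjugates \<open>H\<close> into
  itself.\<close>

lemma p_group_normalizer_grows:
  assumes sH: "subgroup H G" and sK: "subgroup K G" and HK: "H \<subset> K"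
    and cK: "card K = p ^ k" and p: "prime p"
  shows "\<exists>x\<in>K - H. \<forall>h\<in>H. x \<otimes> h \<otimes> inv x \<in> H"
proof -
  let ?E = "(\<lambda>x. H #> x) ` K"
  have HK': "H \<subseteq> K" using HK by auto
  have Hc: "H \<subseteq> carrier G" and Kc: "K \<subseteq> carrier G" using sH sK subgroup.subset by auto
  interpret act: group_action "G\<lparr>carrier := H\<rparr>" ?E "\<lambda>h. \<lambda>R\<in>?E. R #> inv h"
    by (rule coset_action[OF sH sK HK'])
  interpret K: group "G\<lparr>carrier := K\<rparr>" by (rule subgroup_imp_group[OF sK])
  have "subgroup H (G\<lparr>carrier := K\<rparr>)" using subgroup_incl[OF sH sK HK'] .
  then have "card (rcosets\<^bsub>G\<lparr>carrier := K\<rparr>\<^esub> H) * card H = card K"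
    using K.lagrange[of H] by (simp add: order_def)
  moreover have "rcosets\<^bsub>G\<lparr>carrier := K\<rparr>\<^esub> H = ?E"
    unfolding RCOSETS_def by auto
  ultimately have lag: "card ?E * card H = p ^ k" using cK by simp
  have fE: "finite ?E" using finite_subgroup[OF sK] by simp
  obtain i where i: "card H = p ^ i"
    using lag divides_primepow_nat[OF p] by (metis dvd_triv_right)
  obtain j where j: "card ?E = p ^ j"
    using lag divides_primepow_nat[OF p] by (metis dvd_triv_left)
  have "j \<noteq> 0"
  proof
    assume "j = 0"
    then have "card H = card K" using lag j cK by simp
    then show False using subgroup_card_eq[OF sH sK HK'] HK by auto
  qed
  then have pE: "p dvd card ?E" using j by simp
  have one: "H #> \<one> = H" using Hc by simp
  have HE: "H \<in> ?E" using one subgroup.one_closed[OF sK] by (metis imageI)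
  have fx: "\<forall>g\<in>carrier (G\<lparr>carrier := H\<rparr>). (\<lambda>R\<in>?E. R #> inv g) H = H"
    using HE subgroup.rcos_const[OF sH is_group] subgroup.m_inv_closed[OF sH] by simp
  have "order (G\<lparr>carrier := H\<rparr>) = p ^ i" using i by (simp add: order_def)
  from act.p_group_second_fixed_point[OF this p fE pE HE fx]
  obtain R where R: "R \<in> ?E" "R \<noteq> H" "\<forall>g\<in>H. R #> inv g = R" by auto
  then obtain x where x: "x \<in> K" "R = H #> x" by auto
  have xc: "x \<in> carrier G" using x Kc by auto
  have "x \<notin> H" using R(2) x(2) subgroup.rcos_const[OF sH is_group] by auto
  moreover have "x \<otimes> h \<otimes> inv x \<in> H" if h: "h \<in> H" for h
  proof -
    have ih: "inv h \<in> H" "h \<in> carrier G" using subgroup.m_inv_closed[OF sH h] h Hc by auto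
    \<comment> \<open>The action multiplies by inverses, so the fixed point property is taken at
      \<open>inv h\<close>.\<close>
    have "R #> inv (inv h) = R" using R(3) ih by blast
    then have "H #> (x \<otimes> h) = H #> x" using x(2) ih xc Hc by (simp add: coset_mult_assoc)
    then have "x \<otimes> h \<in> H #> x" using rcos_self[of "x \<otimes> h" H] sH xc ih by simp
    then show ?thesis using subgroup.rcos_module[OF sH is_group xc, of "x \<otimes> h"] xc ih by simp
  qed
  ultimately show ?thesis using x(1) by blast
qed

text \<open>The normalizer \<open>?N\<close> of \<open>H\<close> in \<open>K\<close> is strictly
  larger than \<open>H\<close> by \<open>p_group_normalizer_grows\<close>; nothing lies strictly
  between \<open>H\<close> and \<open>K\<close>, so it is \<open>K\<close>.\<close>

lemma p_group_cover_normal: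
  assumes cov: "covered_by G H K" and cK: "card K = p ^ k" and p: "prime p"
  shows "\<forall>x\<in>K. \<forall>h\<in>H. x \<otimes> h \<otimes> inv x \<in> H"
proof -
  have sH: "subgroup H G" and sK: "subgroup K G" and HK: "H \<subset> K"
    using cov unfolding covered_by_def by auto
  have Hc: "H \<subseteq> carrier G" and Kc: "K \<subseteq> carrier G" using sH sK subgroup.subset by auto
  let ?N = "{x \<in> K. \<forall>h\<in>H. x \<otimes> h \<otimes> inv x \<in> H}"
  have "subgroup ?N G"
  proof (rule subgroupI)
    show "?N \<subseteq> carrier G" using Kc by auto
    have "\<one> \<in> ?N" using subgroup.one_closed[OF sK] Hc by auto
    then show "?N \<noteq> {}" by blast
  next
    fix x assume x: "x \<in> ?N"
    then have xc: "x \<in> carrier G" using Kc by auto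
    let ?f = "\<lambda>h. x \<otimes> h \<otimes> inv x"
    \<comment> \<open>Finiteness makes conjugation by \<open>x\<close> map \<open>H\<close> onto
      itself, so it can be undone within \<open>H\<close>.\<close>
    have "inj_on ?f H" using xc Hc by (intro inj_onI) (simp add: subset_iff)
    moreover have "?f ` H \<subseteq> H" using x by auto
    ultimately have surj: "?f ` H = H" using endo_inj_surj finite_subgroup[OF sH] by blast
    have "inv x \<otimes> h \<otimes> inv (inv x) \<in> H" if "h \<in> H" for h
    proof -
      have "h \<in> ?f ` H" unfolding surj by (rule that)
      then obtain g where g: "g \<in> H" "h = x \<otimes> g \<otimes> inv x" by (rule imageE) simp
      have "inv x \<otimes> h \<otimes> inv (inv x) = g" unfolding g(2) using subsetD[OF Hc g(1)] xc by (simp add: m_assoc)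
      then show ?thesis using g(1) by simp
    qed
    then show "inv x \<in> ?N" using x subgroup.m_inv_closed[OF sK] by auto
  next
    fix x y assume x: "x \<in> ?N" and y: "y \<in> ?N"
    have xc: "x \<in> carrier G" "y \<in> carrier G" using x y Kc by auto
    have "x \<otimes> y \<otimes> h \<otimes> inv (x \<otimes> y) \<in> H" if h: "h \<in> H" for h
    proof -
      have "x \<otimes> (y \<otimes> h \<otimes> inv y) \<otimes> inv x \<in> H" using x y h by auto
      moreover have "x \<otimes> (y \<otimes> h \<otimes> inv y) \<otimes> inv x = x \<otimes> y \<otimes> h \<otimes> inv (x \<otimes> y)"
        using xc subsetD[OF Hc h] by (simp add: m_assoc inv_mult_group)
      ultimately show ?thesis by simp
    qed
    then show "x \<otimes> y \<in> ?N" using x y subgroup.m_closed[OF sK] by auto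
  qed
  moreover have "H \<subset> ?N"
  proof -
    have "H \<subseteq> ?N" using HK sH by (auto intro: subgroup.m_closed subgroup.m_inv_closed)
    moreover obtain x where "x \<in> ?N" "x \<notin> H"
      using p_group_normalizer_grows[OF sH sK HK cK p] by blast
    ultimately show ?thesis by blast
  qed
  ultimately have "?N = K" using cov unfolding covered_by_def by blast
  then show ?thesis by blast
qed

text \<open>Raising an element outside \<open>H\<close> repeatedly to the \<open>p\<close>-th power
  ends at \<open>\<one>\<close>, hence in \<open>H\<close>; the witness is the last value before
  \<open>H\<close> is first reached.\<close>

lemma p_group_last_power:
  assumes sH: "subgroup H G" and sK: "subgroup K G" and HK: "H \<subset> K" and cK: "card K = p ^ k"
  shows "\<exists>x\<in>K - H. x [^] p \<in> H"
proof -
  obtain y where y: "y \<in> K" "y \<notin> H" using HK by auto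
  have yc: "y \<in> carrier G" using subgroup.mem_carrier[OF sK y(1)] .
  let ?n = "LEAST n. y [^] (p ^ n) \<in> H"
  have "y [^] (p ^ k) = \<one>" using ord_dvd_card[OF sK y(1)] cK pow_eq_id[OF yc] by simp
  then have "y [^] (p ^ k) \<in> H" using subgroup.one_closed[OF sH] by simp
  then have n: "y [^] (p ^ ?n) \<in> H" by (rule LeastI)
  have "?n \<noteq> 0"
  proof
    assume "?n = 0"
    then have "y [^] (p ^ 0) \<in> H" using n by simp
    then show False using y(2) yc by simp
  qed
  then obtain m where m: "?n = Suc m" using not0_implies_Suc by blast
  have "y [^] (p ^ m) \<notin> H" using not_less_Least[of m "\<lambda>n. y [^] (p ^ n) \<in> H"] m by simp
  moreover have "(y [^] (p ^ m)) [^] p \<in> H"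
    using n m yc by (simp add: nat_pow_pow mult.commute)
  ultimately show ?thesis using subgroup_pow_closed[OF sK y(1)] by blast
qed

section \<open>Extensions of a cyclic p-group for odd p\<close>

text \<open>Moving \<open>x\<close> past a power of \<open>c\<close> multiplies the exponent by
  \<open>t\<close>, so the collected exponents form a geometric sum.\<close>

lemma twisted_pow:
  assumes c: "c \<in> carrier G" and x: "x \<in> carrier G" and xc: "x \<otimes> c \<otimes> inv x = c [^] (t::nat)"
  shows "(c [^] s \<otimes> x) [^] n = c [^] (s * (\<Sum>j<n. t ^ j)) \<otimes> x [^] (n::nat)"
proof -
  have sw: "x \<otimes> c [^] m = c [^] (t * m) \<otimes> x" for m :: nat
  proof -
    have "x \<otimes> c [^] m \<otimes> inv x = c [^] (t * m)"
      using conj_pow[OF x c, of m] xc c by (simp add: nat_pow_pow)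
    then show ?thesis using c x by (metis inv_solve_right m_closed nat_pow_closed)
  qed
  show ?thesis
  proof (induction n)
    case (Suc n)
    let ?S = "\<Sum>j<n. t ^ j"
    have S: "(\<Sum>j<Suc n. t ^ j) = 1 + t * ?S"
      by (simp add: sum.lessThan_Suc_shift sum_distrib_left del: sum.lessThan_Suc)
    have "(c [^] s \<otimes> x) [^] Suc n = (c [^] s \<otimes> x) \<otimes> (c [^] s \<otimes> x) [^] n"
      using c x by (intro nat_pow_Suc2) simp
    also have "\<dots> = c [^] s \<otimes> (x \<otimes> c [^] (s * ?S)) \<otimes> x [^] n"
      using Suc c x by (simp add: m_assoc)
    also have "\<dots> = (c [^] s \<otimes> c [^] (t * (s * ?S))) \<otimes> (x \<otimes> x [^] n)"
      using sw c x by (simp add: m_assoc)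
    also have "\<dots> = c [^] (s * (1 + t * ?S)) \<otimes> x [^] Suc n"
      using c x nat_pow_Suc2[OF x, of n] by (simp add: nat_pow_mult algebra_simps)
    finally show ?case unfolding S .
  qed simp
qed

text \<open>Conjugation by \<open>x\<close> raises \<open>c\<close> to a power \<open>t\<close> with \<open>t \<equiv> 1\<close> modulo \<open>p\<close>, so the exponent
  \<open>1 + t + \<dots> + t\<^bsup>p-1\<^esup>\<close> of the \<open>p\<close>-th power formula is \<open>p\<close> times a unit and \<open>s\<close> can be solved for.\<close>

lemma odd_extension_has_new_prime_element:
  assumes p: "prime p" "odd p" and c: "c \<in> carrier G" "ord c = p ^ i" "i \<noteq> 0"
    and x: "x \<in> carrier G" "x \<otimes> c \<otimes> inv x \<in> generate G {c}" "x [^] p = c [^] (p * m)"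
  shows "\<exists>s::nat. (c [^] s \<otimes> x) [^] p = \<one>"
proof -
  obtain t :: nat where t: "x \<otimes> c \<otimes> inv x = c [^] t" using generateE[OF x(2) c(1)] by blast
  have it: "x [^] n \<otimes> c \<otimes> inv (x [^] n) = c [^] (t ^ n)" for n :: nat
  proof (induction n)
    case (Suc n)
    have "x [^] Suc n \<otimes> c \<otimes> inv (x [^] Suc n) = x \<otimes> (x [^] n \<otimes> c \<otimes> inv (x [^] n)) \<otimes> inv x"
      using c x by (simp only: nat_pow_Suc2[OF x(1)]) (simp add: m_assoc inv_mult_group)
    also have "\<dots> = (x \<otimes> c \<otimes> inv x) [^] (t ^ n)"
      using Suc conj_pow[OF x(1) c(1)] by simp
    finally show ?case using t c by (simp add: nat_pow_pow)
  qed (use c in simp)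
  \<comment> \<open>As a power of \<open>c\<close>, \<open>x [^] p\<close> centralizes
    \<open>c\<close>; compared with \<open>it\<close> this gives \<open>t ^ p = 1\<close> modulo
    \<open>p ^ i\<close>.\<close>
  have "x [^] p \<otimes> c \<otimes> inv (x [^] p) = c"
  proof -
    have "x [^] p \<otimes> c = c \<otimes> x [^] p"
      unfolding x(3) using nat_pow_Suc2[OF c(1), of "p * m"] by simp
    then show ?thesis using c(1) x(1) by (simp add: m_assoc)
  qed
  then have "c [^] (t ^ p) = c [^] (1::nat)" using it[of p] c(1) by simp
  then have "[t ^ p = 1] (mod p ^ i)" using pow_eq_pow_iff_cong[OF c(1)] c(2) by metis
  then have tp: "[t ^ p = 1] (mod p)" 
    by (rule cong_dvd_modulus_nat) (use c(3) in simp)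
  have "\<not> p dvd t"
  proof
    assume "p dvd t"
    then have "p dvd t ^ p" using p prime_gt_0_nat by (simp add: dvd_power_iff_le dvd_trans)
    then have "p dvd 1" using tp cong_dvd_iff by blast
    then show False using p by auto
  qed
  \<comment> \<open>Fermat gives \<open>t ^ p = t\<close> modulo \<open>p\<close>, so
    \<open>t ^ p = 1\<close> becomes \<open>t = 1\<close>.\<close>
  then have "[t ^ (p - 1) = 1] (mod p)" using fermat_theorem p(1) by blast
  then have "[t * t ^ (p - 1) = t * 1] (mod p)" by (rule cong_scalar_left)
  moreover have "t * t ^ (p - 1) = t ^ p"
    using p prime_gt_0_nat by (metis power_eq_if neq0_conv)
  ultimately have "[t = 1] (mod p)" using tp by (metis cong_sym cong_trans mult.right_neutral)
  then obtain v where v: "(\<Sum>j<p. t ^ j) = p * v" "coprime v p"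
    using geometric_sum_prime[OF p] by blast
  have "coprime v (p ^ i)" using v(2) by simp
  then obtain w where w: "[v * w = 1] (mod p ^ i)" using cong_solve_coprime_nat by fastforce
  \<comment> \<open>To cancel \<open>x [^] p = c [^] (p * m)\<close> it suffices that
    \<open>?s * v\<close> is \<open>-m\<close> modulo \<open>p ^ i\<close>: \<open>w\<close> inverts
    \<open>v\<close>, and \<open>p ^ i - 1\<close> stands for -1 among the naturals.\<close>
  let ?s = "w * (m * (p ^ i - 1))"
  have pi: "0 < p ^ i" using p prime_gt_0_nat by simp
  have "[v * w * (m * (p ^ i - 1)) + m = 1 * (m * (p ^ i - 1)) + m] (mod p ^ i)"
    using w by (intro cong_add cong_scalar_right cong_refl)
  also have "1 * (m * (p ^ i - 1)) + m = m * p ^ i"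
    using pi by (metis (no_types, lifting) Suc_pred' mult_Suc_right add.commute mult_1 One_nat_def)
  also have "[m * p ^ i = 0] (mod p ^ i)" by (simp add: cong_def)
  finally have "p ^ i dvd v * w * (m * (p ^ i - 1)) + m" by (simp add: cong_0_iff)
  then have "p ^ i dvd p * (v * w * (m * (p ^ i - 1)) + m)" by simp
  also have "p * (v * w * (m * (p ^ i - 1)) + m) = ?s * (p * v) + p * m" by (simp add: algebra_simps)
  finally have d: "ord c dvd ?s * (p * v) + p * m" using c(2) by simp
  have "(c [^] ?s \<otimes> x) [^] p = c [^] (?s * (p * v)) \<otimes> c [^] (p * m)"
    using twisted_pow[OF c(1) x(1) t, of ?s p] v(1) x(3) by simp
  also have "\<dots> = c [^] (?s * (p * v) + p * m)" using c(1) by (simp add: nat_pow_mult)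
  also have "\<dots> = \<one>" using d pow_eq_id[OF c(1)] by blast
  finally show ?thesis by blast
qed

text \<open>The degree of a largest cyclic \<open>p\<close>-subgroup \<open>?C\<close> is compared
  with that of the trivial subgroup. A cover of \<open>?C\<close> without a new subgroup of prime
  order would be a \<open>p\<close>-group in which \<open>?C\<close> is normal, and the extension
  lemma finds an element of order \<open>p\<close> outside \<open>?C\<close>. So \<open>P\<close> is
  isolated, which \<open>x0\<close> contradicts.\<close>

lemma no_odd_prime_square:
  assumes reg: "subgroup_graph_regular G" and p: "prime p" "odd p"
    and x0: "x0 \<in> carrier G" "ord x0 = p * p"
  shows False
proof -
  let ?I = "{i. \<exists>c\<in>carrier G. ord c = p ^ i}"
  have "i \<le> order G" if "i \<in> ?I" for i
  proof -
    obtain c where c: "c \<in> carrier G" "ord c = p ^ i" using \<open>i \<in> ?I\<close> by blast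
    have "i < p ^ i" using power_gt_expt[of p i] prime_gt_1_nat[OF p(1)] by simp
    then show ?thesis using ord_le_group_order[OF fin c(1)] c(2) by simp
  qed
  then have finI: "finite ?I" using finite_nat_set_iff_bounded_le by blast
  have "2 \<in> ?I" using x0 by (auto simp: power2_eq_square)
  define i where "i = Max ?I"
  have iI: "i \<in> ?I" unfolding i_def using Max_in[OF finI] \<open>2 \<in> ?I\<close> by blast
  have imax: "j \<le> i" if "j \<in> ?I" for j unfolding i_def using Max_ge[OF finI that] .
  have i2: "2 \<le> i" using imax[OF \<open>2 \<in> ?I\<close>] .
  obtain c where c: "c \<in> carrier G" "ord c = p ^ i" using iI by auto
  let ?C = "generate G {c}"
  have sC: "subgroup ?C G" "card ?C = p ^ i" using c subgroup_generate card_generate by auto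
  obtain P where P: "P \<in> prime_subgroups ?C" "card P = p"
    using exists_prime_subgroup[OF sC(1) _ p(1)] sC(2) i2 by auto
  note PD = prime_subgroupsD[OF P(1)]
  have uC: "prime_subgroups ?C = {P}"
  proof -
    have "R = P" if R: "R \<in> prime_subgroups ?C" for R
    proof -
      note D = prime_subgroupsD[OF R]
      have "card R dvd p ^ i" using card_subgroup_dvd[OF D(1) sC(1) D(2)] sC(2) by simp
      then have "card R = p" using D(3) p(1) prime_dvd_power primes_dvd_imp_eq by blast
      then show ?thesis
        using subgroup_of_cyclic[OF c(1) D(1,2)] subgroup_of_cyclic[OF c(1) PD(1,2)] P(2) by metis
    qed
    then show ?thesis using P(1) by blast
  qed
  have "subgroup_graph_degree G {\<one>} = subgroup_graph_degree G ?C"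
    using reg triv_subgroup sC(1) unfolding subgroup_graph_regular_def subgroups_of_def by blast
  then have many: "card (prime_subgroups (carrier G)) \<le> card (covers ?C) + 1"
    unfolding degree_trivial unfolding degree_eq using card_lower_prime_power[OF c p(1)] by simp
  have "prime_subgroups K \<noteq> {P}" if K: "K \<in> covers ?C" for K
  proof
    assume u: "prime_subgroups K = {P}"
    have cov: "covered_by G ?C K" using K unfolding covers_def by simp
    then have sK: "subgroup K G" "?C \<subset> K" unfolding covered_by_def by auto
    have "q = p" if "prime q" "q dvd card K" for q
      using exists_prime_subgroup[OF sK(1) that(2,1)] u P(2) by auto
    then obtain k where k: "card K = p ^ k"
      using prime_power_if_unique_prime_divisor subgroup.finite_imp_card_positive[OF sK(1) fin] by blast
    obtain x where x: "x \<in> K" "x \<notin> ?C" "x [^] p \<in> ?C"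
      using p_group_last_power[OF sC(1) sK k] by blast
    have xc: "x \<in> carrier G" using subgroup.mem_carrier[OF sK(1) x(1)] .
    obtain l :: nat where l: "x [^] p = c [^] l" using generateE[OF x(3) c(1)] by blast
    \<comment> \<open>Otherwise \<open>x [^] p\<close> would generate \<open>?C\<close> and
      \<open>x\<close> would have order \<open>p ^ Suc i\<close>, against the maximality of
      \<open>i\<close>.\<close>
    have "p dvd l"
    proof (rule ccontr)
      assume "\<not> p dvd l"
      then have "coprime l (ord c)" using prime_imp_coprime[OF p(1)] by (simp add: c(2) coprime_commute)
      then have "c \<in> generate G {x [^] p}" using pow_in_generate_coprime[OF c(1)] l by simp
      then have "p ^ i dvd ord (x [^] p)"
        using ord_dvd_card[OF subgroup_generate] card_generate c(2) xc by (metis nat_pow_closed)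
      moreover have "ord (x [^] p) dvd p ^ i" using ord_dvd_card[OF sC(1) x(3)] sC(2) by simp
      ultimately have oxp: "ord (x [^] p) = p ^ i" by (simp add: dvd_antisym)
      have "ord x dvd p ^ k" using ord_dvd_card[OF sK(1) x(1)] k by simp
      then obtain n where n: "ord x = p ^ n" using divides_primepow_nat[OF p(1)] by blast
      have "x \<noteq> \<one>" using x(2) subgroup.one_closed[OF sC(1)] by auto
      then have "n \<noteq> 0" using n ord_eq_1[OF xc] by (metis power_0)
      then obtain m where m: "n = Suc m" using not0_implies_Suc by blast
      have "ord (x [^] p) = ord x div p"
        using ord_pow[OF xc, of p] n m p(1) prime_gt_0_nat by simp
      then have "p ^ m = p ^ i" using oxp n m prime_gt_0_nat[OF p(1)] by simp
      then have "m = i" using prime_gt_1_nat[OF p(1)] by simp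
      then have "Suc i \<in> ?I" using n m xc by blast
      then show False using imax by fastforce
    qed
    then obtain m where m: "l = p * m" by auto
    have "x \<otimes> c \<otimes> inv x \<in> ?C"
      using p_group_cover_normal[OF cov k p(1)] x(1) generate_self[of c] by blast
    then obtain s :: nat where s: "(c [^] s \<otimes> x) [^] p = \<one>"
      using odd_extension_has_new_prime_element[OF p c _ xc] l m i2 by fastforce
    let ?y = "c [^] s \<otimes> x"
    have cs: "c [^] s \<in> ?C" using subgroup_pow_closed[OF sC(1) generate_self] .
    have yK: "?y \<in> K" using cs sK x(1) by (auto intro: subgroup.m_closed)
    have yc: "?y \<in> carrier G" using c xc by simp
    have yC: "?y \<notin> ?C"
    proof
      assume "?y \<in> ?C"
      then have "inv (c [^] s) \<otimes> ?y \<in> ?C"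
        using cs sC(1) by (simp add: subgroup.m_closed subgroup.m_inv_closed)
      then show False using x(2) c xc by simp
    qed
    have "?y \<noteq> \<one>" using yC subgroup.one_closed[OF sC(1)] by auto
    then have "ord ?y \<noteq> 1" using ord_eq_1[OF yc] by simp
    moreover have "ord ?y dvd p" using s pow_eq_id[OF yc] by simp
    ultimately have "ord ?y = p" using p(1) unfolding prime_nat_iff by blast
    then have "generate G {?y} \<in> prime_subgroups K" using generate_prime_subgroup[OF sK(1) yK] p(1) by simp
    then have "?y \<in> P" using u generate_self[of ?y] by simp
    then show False using yC PD(2) by blast
  qed
  then have "isolated P" using isolatedI[OF uC many] by blast
  moreover have "P \<in> prime_subgroups (carrier G)" using PD unfolding prime_subgroups_def by auto
  ultimately show False using isolated_no_prime_square[OF reg, of P x0] x0 P(2) by simp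
qed

end

section \<open>The prime two\<close>

lemma even_card_fixed_point_free_involution:
  assumes "finite A" "\<And>x. x \<in> A \<Longrightarrow> f x \<in> A" "\<And>x. x \<in> A \<Longrightarrow> f (f x) = x" "\<And>x. x \<in> A \<Longrightarrow> f x \<noteq> x"
  shows "even (card A)"
  using assms
proof (induction "card A" arbitrary: A rule: less_induct)
  case less
  show ?case
  proof (cases "A = {}")
    case False
    then obtain a where a: "a \<in> A" by blast
    let ?B = "A - {a, f a}"
    have fa: "f a \<in> A" "f a \<noteq> a" using less.prems(2,4)[OF a] by auto
    have "card {a, f a} = 2" using fa(2) by auto
    moreover have "card ?B = card A - card {a, f a}"
      by (rule card_Diff_subset) (use a fa in auto)
    moreover have "card {a, f a} \<le> card A" by (rule card_mono) (use a fa less.prems(1) in auto)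
    ultimately have cB: "card A = card ?B + 2" by simp
    have "even (card ?B)"
    proof (rule less.hyps)
      show "card ?B < card A" using cB by simp
      show "finite ?B" using less.prems(1) by simp
      fix x assume x: "x \<in> ?B"
      then have xA: "x \<in> A" by simp
      show "f (f x) = x" "f x \<noteq> x" using less.prems(3,4)[OF xA] by auto
      have "f x \<noteq> a" "f x \<noteq> f a"
        using less.prems(3)[OF xA] less.prems(3)[OF a] x by auto
      then show "f x \<in> ?B" using less.prems(2)[OF xA] by simp
    qed
    then show ?thesis using cB by simp
  qed simp
qed

text \<open>Inversion pairs off the elements with \<open>x \<otimes> x \<noteq> \<one>\<close>, so
  their number is even; besides the involutions only \<open>\<one>\<close> is left.\<close>

lemma (in group) odd_card_involutions:
  assumes "finite (carrier G)" "even (order G)"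
  shows "odd (card {x \<in> carrier G. x \<noteq> \<one> \<and> x \<otimes> x = \<one>})"
proof -
  let ?I = "{x \<in> carrier G. x \<noteq> \<one> \<and> x \<otimes> x = \<one>}" and ?S = "{x \<in> carrier G. x \<otimes> x \<noteq> \<one>}"
  have "even (card ?S)"
  proof (rule even_card_fixed_point_free_involution[where f = "\<lambda>x. inv x"])
    show "finite ?S" using assms(1) by simp
    fix x assume x: "x \<in> ?S"
    then show "inv (inv x) = x" by simp
    show "inv x \<noteq> x" using x by (metis (mono_tags, lifting) mem_Collect_eq r_inv)
    have "inv x \<otimes> inv x = inv (x \<otimes> x)" using x by (simp add: inv_mult_group)
    then show "inv x \<in> ?S" using x by simp
  qed
  have "carrier G = insert \<one> (?I \<union> ?S)" by auto
  then have "order G = card (insert \<one> (?I \<union> ?S))" unfolding order_def by (rule arg_cong)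
  also have "card (insert \<one> (?I \<union> ?S)) = Suc (card ?I + card ?S)"
  proof -
    have "card (?I \<union> ?S) = card ?I + card ?S"
      by (rule card_Un_disjoint) (use assms(1) in auto)
    then show ?thesis using assms(1) by (subst card_insert_disjoint) simp_all
  qed
  finally show ?thesis using assms(2) \<open>even (card ?S)\<close> by simp
qed

context finite_group
begin

section \<open>Involutions and subgroups of order four\<close>

lemma centralizer_subgroup:
  assumes "A \<subseteq> carrier G"
  shows "subgroup {x \<in> carrier G. \<forall>a\<in>A. x \<otimes> a = a \<otimes> x} G" (is "subgroup ?C G")
proof (rule subgroupI)
  show "?C \<subseteq> carrier G" by auto
  have "\<one> \<in> ?C" using assms by auto
  then show "?C \<noteq> {}" by blast
next
  fix x assume x: "x \<in> ?C"
  have "inv x \<otimes> a = a \<otimes> inv x" if a: "a \<in> A" for a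
  proof -
    have ac: "a \<in> carrier G" and xc: "x \<in> carrier G" and "x \<otimes> a = a \<otimes> x" using a x assms by auto
    have "inv x \<otimes> a = inv x \<otimes> (a \<otimes> x) \<otimes> inv x" using ac xc by (simp add: m_assoc)
    also have "\<dots> = inv x \<otimes> (x \<otimes> a) \<otimes> inv x" using \<open>x \<otimes> a = a \<otimes> x\<close> by simp
    also have "\<dots> = a \<otimes> inv x" using ac xc by simp
    finally show ?thesis .
  qed
  then show "inv x \<in> ?C" using x by simp
next
  fix x y assume x: "x \<in> ?C" and y: "y \<in> ?C"
  have "x \<otimes> y \<otimes> a = a \<otimes> (x \<otimes> y)" if a: "a \<in> A" for a
  proof -
    have ac: "a \<in> carrier G" "x \<in> carrier G" "y \<in> carrier G" using a x y assms by auto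
    have "x \<otimes> y \<otimes> a = x \<otimes> (y \<otimes> a)" using ac by (simp add: m_assoc)
    also have "y \<otimes> a = a \<otimes> y" using y a by simp
    also have "x \<otimes> (a \<otimes> y) = x \<otimes> a \<otimes> y" using ac by (simp add: m_assoc)
    also have "x \<otimes> a = a \<otimes> x" using x a by simp
    finally show ?thesis using ac by (simp add: m_assoc)
  qed
  then show "x \<otimes> y \<in> ?C" using x y by simp
qed

lemma generate_involution:
  assumes "z \<in> carrier G" "ord z = 2"
  shows "generate G {z} = {\<one>, z}"
proof -
  have s: "subgroup (generate G {z}) G" using subgroup_generate[OF assms(1)] .
  have "z \<noteq> \<one>" using assms(2) by auto
  then have "card {\<one>, z} = card (generate G {z})" using card_generate[OF assms(1)] assms(2) by simp
  moreover have "{\<one>, z} \<subseteq> generate G {z}" using generate_self subgroup.one_closed[OF s] by simp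
  ultimately show ?thesis using card_subset_eq[OF finite_subgroup[OF s]] by metis
qed

lemma ord_eq_2_iff:
  assumes "z \<in> carrier G"
  shows "ord z = 2 \<longleftrightarrow> z \<noteq> \<one> \<and> z \<otimes> z = \<one>"
proof -
  have "z \<otimes> z = z [^] (2::nat)" using assms by (simp add: numeral_2_eq_2)
  then have "z \<otimes> z = \<one> \<longleftrightarrow> ord z dvd 2" using pow_eq_id[OF assms] by simp
  moreover have "ord z dvd 2 \<longleftrightarrow> ord z = 1 \<or> ord z = 2"
    using two_is_prime_nat by (auto simp: prime_nat_iff)
  ultimately show ?thesis using ord_eq_1[OF assms] by auto
qed

lemma four_group:
  assumes z: "z \<in> carrier G" "z \<noteq> \<one>" "z \<otimes> z = \<one>"
    and x: "x \<in> carrier G" "x \<notin> {\<one>, z}" "x \<otimes> z = z \<otimes> x" "x \<otimes> x \<in> {\<one>, z}"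
  shows "subgroup {\<one>, z, x, z \<otimes> x} G" (is "subgroup ?K G") "card {\<one>, z, x, z \<otimes> x} = 4"
proof -
  have zz: "z \<otimes> (z \<otimes> y) = y" if "y \<in> carrier G" for y
    using z that by (simp flip: m_assoc)
  have xz: "x \<otimes> (z \<otimes> y) = z \<otimes> (x \<otimes> y)" if "y \<in> carrier G" for y
    using z x that by (metis m_assoc)
  have "z \<otimes> x \<noteq> \<one>" using zz[OF x(1)] x(2) z(1) by auto
  moreover have "z \<otimes> x \<noteq> z" using x(1,2) z(1,2) by simp
  moreover have "z \<otimes> x \<noteq> x" using x(1,2) z(1,2) by simp
  ultimately show "card ?K = 4" using x(2) z(2) by auto
  have cl: "a \<otimes> b \<in> ?K" if "a \<in> ?K" "b \<in> ?K" for a b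
  proof -
    obtain q where q: "x \<otimes> x = q" by blast
    have qc: "q \<in> carrier G" using q x(1) by blast
    have qK: "q \<in> ?K" "z \<otimes> q \<in> ?K" using x(4) z unfolding q by (elim insertE emptyE; simp)+
    have e: "x \<otimes> (z \<otimes> x) = z \<otimes> q" "z \<otimes> x \<otimes> z = x" "z \<otimes> x \<otimes> x = z \<otimes> q"
      "z \<otimes> x \<otimes> (z \<otimes> x) = q"
      using xz[OF x(1)] zz[OF x(1)] zz[OF qc] x(1,3) z(1) q by (simp_all add: m_assoc)
    show ?thesis using that
      by (elim insertE emptyE) (use e q qK z x(1,3) zz[OF x(1)] in simp_all)
  qed
  have c: "?K \<subseteq> carrier G" using x z by auto
  show "subgroup ?K G"
  proof (rule subgroupI)
    fix a assume a: "a \<in> ?K"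
    then have ac: "a \<in> carrier G" using c by blast
    \<comment> \<open>In a finite group inverses are powers, so closure under products suffices; the
      exponent \<open>ord a - 1\<close> is 0 only when \<open>a\<close> is the identity.\<close>
    have pw: "a [^] Suc n \<in> ?K" for n
      by (induction n) (use a ac cl in auto)
    have "a \<otimes> a [^] (ord a - 1) = a [^] ord a"
      using ord_pos[OF ac] ac by (metis Suc_pred' nat_pow_Suc2)
    then have "a \<otimes> a [^] (ord a - 1) = \<one>" using ac by simp
    then have i: "inv a = a [^] (ord a - 1)" using ac
      by (metis inv_solve_left' nat_pow_closed one_closed r_one inv_closed)
    show "inv a \<in> ?K"
    proof (cases "ord a - 1")
      case 0
      then show ?thesis using i by simp
    next
      case (Suc n)
      then show ?thesis using i pw[of n] by simp
    qed
  qed (use c cl in auto)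
qed

text \<open>Counting shows that \<open>\<one>\<close>, \<open>z\<close>, \<open>x\<close> and
  \<open>z \<otimes> x\<close> exhaust \<open>K\<close>; cancellation then leaves one place for
  \<open>x \<otimes> z\<close> and two for \<open>x \<otimes> x\<close>. This is a converse of
  \<open>four_group\<close>.\<close>

lemma order_four_overgroup:
  assumes z: "z \<in> carrier G" "ord z = 2" and K: "subgroup K G" "z \<in> K" "card K = 4"
  shows "\<exists>x\<in>K. x \<notin> {\<one>, z} \<and> x \<otimes> z = z \<otimes> x \<and> x \<otimes> x \<in> {\<one>, z} \<and> K = {\<one>, z, x, z \<otimes> x}"
proof -
  have z1: "z \<noteq> \<one>" "z \<otimes> z = \<one>" using ord_eq_2_iff[OF z(1)] z(2) by auto
  have oneK: "\<one> \<in> K" using subgroup.one_closed[OF K(1)] .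
  have "\<not> K \<subseteq> {\<one>, z}"
  proof
    assume "K \<subseteq> {\<one>, z}"
    then have "card K \<le> card {\<one>, z}" by (rule card_mono[rotated]) simp
    then show False using K(3) z1 by simp
  qed
  then obtain x where x: "x \<in> K" "x \<notin> {\<one>, z}" by blast
  have xc: "x \<in> carrier G" using subgroup.mem_carrier[OF K(1) x(1)] .
  have zx: "z \<otimes> x \<noteq> \<one>" "z \<otimes> x \<noteq> z" "z \<otimes> x \<noteq> x"
  proof -
    show "z \<otimes> x \<noteq> \<one>"
    proof
      assume "z \<otimes> x = \<one>"
      then have "z \<otimes> x = z \<otimes> z" using z1 by simp
      then show False using x(2) xc z(1) by simp
    qed
    show "z \<otimes> x \<noteq> z" using x(2) z(1) xc by simp
    show "z \<otimes> x \<noteq> x" using z1(1) z(1) xc by simp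
  qed
  have "card {\<one>, z, x, z \<otimes> x} = 4" using zx x(2) z1 by auto
  moreover have sub: "{\<one>, z, x, z \<otimes> x} \<subseteq> K"
    using oneK K(2) x(1) subgroup.m_closed[OF K(1)] by auto
  ultimately have KK: "K = {\<one>, z, x, z \<otimes> x}"
    using card_subset_eq[OF finite_subgroup[OF K(1)] sub] K(3) by simp
  have "x \<otimes> z \<in> K" "x \<otimes> x \<in> K" using x(1) K(2) subgroup.m_closed[OF K(1)] by auto
  moreover have "x \<otimes> z \<noteq> \<one>"
  proof
    assume "x \<otimes> z = \<one>"
    then have "x \<otimes> z = z \<otimes> z" using z1 by simp
    then show False using x(2) xc z(1) by simp
  qed
  moreover have "x \<otimes> z \<noteq> z" using x(2) z(1) xc by simp
  moreover have "x \<otimes> z \<noteq> x" using z1(1) z(1) xc by simp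
  moreover have "x \<otimes> x \<noteq> x" using x(2) xc by simp
  moreover have "x \<otimes> x \<noteq> z \<otimes> x" using x(2) xc z(1) by auto
  ultimately have "x \<otimes> z = z \<otimes> x" "x \<otimes> x \<in> {\<one>, z}" unfolding KK by auto
  then show ?thesis using x KK by blast
qed

text \<open>Each subgroup of order 2 is given by its unique involution. The number of involutions is
  odd, and \<open>z\<close> is left out.\<close>

lemma even_card_other_involutions:
  assumes z: "z \<in> carrier G" "ord z = 2"
  shows "even (card {Q \<in> prime_subgroups (carrier G). card Q = 2 \<and> Q \<noteq> generate G {z}})"
proof -
  let ?I = "{x \<in> carrier G. x \<noteq> \<one> \<and> x \<otimes> x = \<one>}"
  let ?T = "{Q \<in> prime_subgroups (carrier G). card Q = 2 \<and> Q \<noteq> generate G {z}}"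
  have I: "x \<in> ?I \<longleftrightarrow> x \<in> carrier G \<and> ord x = 2" for x using ord_eq_2_iff by auto
  have "even (order G)" using ord_dvd_group_order[OF z(1)] z(2) by simp
  then have odd: "odd (card ?I)" using odd_card_involutions fin by blast
  have zI: "z \<in> ?I" using I z by blast
  have "bij_betw (\<lambda>x. generate G {x}) (?I - {z}) ?T"
    unfolding bij_betw_def
  proof
    show inj: "inj_on (\<lambda>x. generate G {x}) (?I - {z})"
    proof (rule inj_onI)
      fix x y assume x: "x \<in> ?I - {z}" and y: "y \<in> ?I - {z}" and e: "generate G {x} = generate G {y}"
      have "x \<in> generate G {y}" using generate_self[of x] e by simp
      moreover have "generate G {y} = {\<one>, y}" using generate_involution[of y] I[of y] y by blast
      ultimately show "x = y" using x by auto
    qed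
    show "(\<lambda>x. generate G {x}) ` (?I - {z}) = ?T"
    proof (intro equalityI subsetI)
      fix Q assume "Q \<in> (\<lambda>x. generate G {x}) ` (?I - {z})"
      then obtain x where x: "x \<in> ?I" "x \<noteq> z" "Q = generate G {x}" by auto
      then have xc: "x \<in> carrier G" "ord x = 2" using I by auto
      have "Q \<in> prime_subgroups (carrier G)"
        using generate_prime_subgroup[OF subgroup_self xc(1)] xc(2) x(3) two_is_prime_nat by simp
      moreover have "card Q = 2" using card_generate xc x(3) by simp
      moreover have "x \<notin> generate G {z}" using generate_involution[OF z] x(1,2) by auto
      then have "Q \<noteq> generate G {z}" using x(3) generate_self[of x] by auto
      ultimately show "Q \<in> ?T" by simp
    next
      fix Q assume Q: "Q \<in> ?T"
      then obtain x where x: "x \<in> carrier G" "generate G {x} = Q" "ord x = card Q"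
        using prime_subgroup_obtain[of Q "carrier G"] by blast
      then have "x \<in> ?I - {z}" using Q I[of x] by auto
      then show "Q \<in> (\<lambda>x. generate G {x}) ` (?I - {z})" using x(2) by blast
    qed
  qed
  then have "card (?I - {z}) = card ?T" by (rule bij_betw_same_card)
  moreover have "card ?I = Suc (card (?I - {z}))"
    using card_Suc_Diff1[of ?I z] zI fin by simp
  ultimately show ?thesis using odd by simp
qed

text \<open>These subgroups centralize \<open>z\<close>, so they correspond to the involutions of
  \<open>C\<close> modulo \<open>{\<one>, z}\<close>, where \<open>C\<close> is the centralizer of
  \<open>z\<close>. The quotient has even order because \<open>w\<close> lies in
  \<open>C\<close>.\<close>

lemma odd_card_order_four_overgroups:
  assumes w: "w \<in> carrier G" "ord w = 4" and z: "z = w \<otimes> w"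
  shows "odd (card {K. subgroup K G \<and> z \<in> K \<and> card K = 4})"
proof -
  let ?F = "{K. subgroup K G \<and> z \<in> K \<and> card K = 4}"
  let ?Z = "{\<one>, z}"
  have zc: "z \<in> carrier G" using w z by simp
  have "z = w [^] (2::nat)" using w z by (simp add: numeral_2_eq_2)
  then have oz: "ord z = 2" using ord_pow[OF w(1), of 2] w(2) by simp
  then have z1: "z \<noteq> \<one>" "z \<otimes> z = \<one>" using ord_eq_2_iff[OF zc] by auto
  have sZ: "subgroup ?Z G" using generate_involution[OF zc oz] subgroup_generate[OF zc] by simp
  define C where "C = {x \<in> carrier G. \<forall>a\<in>{z}. x \<otimes> a = a \<otimes> x}"
  have C: "x \<in> C \<longleftrightarrow> x \<in> carrier G \<and> x \<otimes> z = z \<otimes> x" for x unfolding C_def by simp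
  have sC: "subgroup C G" unfolding C_def using centralizer_subgroup[of "{z}"] zc by simp
  have ZC: "?Z \<subseteq> C" using zc C by auto
  have "w \<in> C" using w z C by (simp add: m_assoc)
  then have four: "4 dvd card C" using ord_dvd_card[OF sC, of w] w(2) by simp
  let ?H = "G\<lparr>carrier := C\<rparr>"
  interpret H: group ?H by (rule subgroup_imp_group[OF sC])
  have sZH: "subgroup ?Z ?H" by (rule subgroup_incl[OF sZ sC ZC])
  have normal: "?Z \<lhd> ?H"
  proof (rule H.normal_invI[OF sZH])
    fix x h assume x: "x \<in> carrier ?H" and h: "h \<in> ?Z"
    have xC: "x \<in> C" and xc: "x \<in> carrier G" "x \<otimes> z = z \<otimes> x" using x C by auto
    have "inv\<^bsub>?H\<^esub> x = inv x" using m_inv_consistent[OF sC xC] .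
    moreover have "x \<otimes> h \<otimes> inv x = h" using h xc zc by (auto simp: m_assoc)
    ultimately show "x \<otimes>\<^bsub>?H\<^esub> h \<otimes>\<^bsub>?H\<^esub> inv\<^bsub>?H\<^esub> x \<in> ?Z" using h by simp
  qed
  interpret Q: group "?H Mod ?Z" by (rule normal.factorgroup_is_group[OF normal])
  have "card (rcosets\<^bsub>?H\<^esub> ?Z) * card ?Z = card C"
    using H.lagrange[OF sZH] by (simp add: order_def)
  then have ordQ: "order (?H Mod ?Z) * 2 = card C"
    using z1 by (simp add: order_def FactGroup_def)
  then have "even (order (?H Mod ?Z))" using four by auto
  moreover have "0 < card C" using subgroup.finite_imp_card_positive[OF sC fin] .
  then have "finite (carrier (?H Mod ?Z))"
    using ordQ Q.order_gt_0_iff_finite by (metis mult_0 neq0_conv)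
  ultimately have odd: "odd (card {Y \<in> carrier (?H Mod ?Z). Y \<noteq> \<one>\<^bsub>?H Mod ?Z\<^esub> \<and> Y \<otimes>\<^bsub>?H Mod ?Z\<^esub> Y = \<one>\<^bsub>?H Mod ?Z\<^esub>})"
    (is "odd (card ?J)") by (intro Q.odd_card_involutions)
  have coset: "?Z #> x = {x, z \<otimes> x}" if "x \<in> carrier G" for x
    using that unfolding r_coset_def by auto
  have J: "\<exists>x. x \<in> carrier G \<and> x \<otimes> z = z \<otimes> x \<and> x \<notin> ?Z \<and> x \<otimes> x \<in> ?Z \<and> Y = {x, z \<otimes> x} \<and> z \<otimes> x \<notin> ?Z"
    if Y: "Y \<in> ?J" for Y
  proof -
    obtain x where x: "x \<in> C" "Y = ?Z #> x" using Y by (auto simp: carrier_FactGroup)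
    have xc: "x \<in> carrier G" "x \<otimes> z = z \<otimes> x" using x(1) C by auto
    have Yx: "Y = {x, z \<otimes> x}" using x(2) coset[OF xc(1)] by simp
    have YZ: "Y \<noteq> ?Z" "Y <#> Y = ?Z" using Y by auto
    have xZ: "x \<notin> ?Z"
      using YZ(1) x(2) subgroup.rcos_const[OF sZ is_group] by blast
    have "x \<otimes> x \<in> Y <#> Y" unfolding set_mult_def Yx by auto
    then have xx: "x \<otimes> x \<in> ?Z" using YZ(2) by simp
    have zz: "z \<otimes> (z \<otimes> x) = x" using xc zc z1 by (simp flip: m_assoc)
    have "z \<otimes> x \<notin> ?Z"
    proof
      assume "z \<otimes> x \<in> ?Z"
      then have "z \<otimes> (z \<otimes> x) \<in> ?Z" using subgroup.m_closed[OF sZ] by blast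
      then show False using xZ zz by simp
    qed
    then show ?thesis using xc xZ xx Yx by blast
  qed
  \<comment> \<open>An involution of the quotient is a coset \<open>{x, z \<otimes> x}\<close>; it
    corresponds to its union with \<open>?Z\<close>, and removing \<open>?Z\<close> leads
    back.\<close>
  have "bij_betw (\<lambda>Y. ?Z \<union> Y) ?J ?F"
  proof (rule bij_betw_byWitness[where f' = "\<lambda>K. K - ?Z"])
    show "\<forall>Y\<in>?J. ?Z \<union> Y - ?Z = Y"
    proof
      fix Y assume "Y \<in> ?J"
      then obtain x where "x \<notin> ?Z" "Y = {x, z \<otimes> x}" "z \<otimes> x \<notin> ?Z" using J by blast
      then show "?Z \<union> Y - ?Z = Y" by auto
    qed
    show "\<forall>K\<in>?F. ?Z \<union> (K - ?Z) = K"
    proof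
      fix K assume "K \<in> ?F"
      then have "z \<in> K" "\<one> \<in> K" using subgroup.one_closed by auto
      then show "?Z \<union> (K - ?Z) = K" by blast
    qed
    show "(\<lambda>Y. ?Z \<union> Y) ` ?J \<subseteq> ?F"
    proof
      fix K assume "K \<in> (\<lambda>Y. ?Z \<union> Y) ` ?J"
      then obtain Y where Y: "Y \<in> ?J" "K = ?Z \<union> Y" by (rule imageE) simp
      obtain x where x: "x \<in> carrier G" "x \<otimes> z = z \<otimes> x" "x \<notin> ?Z" "x \<otimes> x \<in> ?Z" "Y = {x, z \<otimes> x}"
        using J[OF Y(1)] by blast
      have "K = {\<one>, z, x, z \<otimes> x}" using Y(2) x(5) by auto
      then show "K \<in> ?F" using four_group[OF zc z1 x(1,3,2,4)] by simp
    qed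
    show "(\<lambda>K. K - ?Z) ` ?F \<subseteq> ?J"
    proof
      fix Y assume "Y \<in> (\<lambda>K. K - ?Z) ` ?F"
      then obtain K where K: "subgroup K G" "z \<in> K" "card K = 4" "Y = K - ?Z" by blast
      obtain x where x: "x \<in> K" "x \<notin> ?Z" "x \<otimes> z = z \<otimes> x" "x \<otimes> x \<in> ?Z" "K = {\<one>, z, x, z \<otimes> x}"
        using order_four_overgroup[OF zc oz K(1,2,3)] by blast
      have xc: "x \<in> carrier G" using subgroup.mem_carrier[OF K(1) x(1)] .
      have "z \<otimes> x \<notin> ?Z"
      proof
        assume "z \<otimes> x \<in> ?Z"
        then have "K \<subseteq> {\<one>, z, x}" using x(5) by auto
        then have "card K \<le> card {\<one>, z, x}" by (rule card_mono[rotated]) simp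
        also have "\<dots> \<le> 3" by (simp add: card_insert_if)
        finally show False using K(3) by simp
      qed
      then have Yx: "Y = {x, z \<otimes> x}" using K(4) x(2,5) by auto
      have xC: "x \<in> C" using xc x(3) C by simp
      have Yc: "Y = ?Z #> x" using Yx coset[OF xc] by simp
      have "Y \<in> carrier (?H Mod ?Z)" using Yc xC by (auto simp: carrier_FactGroup)
      moreover have "Y \<noteq> ?Z" using Yx x(2) by auto
      moreover have "Y <#> Y = ?Z"
      proof -
        have "(?Z #>\<^bsub>?H\<^esub> x) <#>\<^bsub>?H\<^esub> (?Z #>\<^bsub>?H\<^esub> x) = ?Z #>\<^bsub>?H\<^esub> (x \<otimes>\<^bsub>?H\<^esub> x)"
          by (rule normal.rcos_sum[OF normal]) (use xC in simp_all)
        then have "Y <#> Y = ?Z #> (x \<otimes> x)" using Yc by simp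
        then show ?thesis using subgroup.rcos_const[OF sZ is_group x(4)] by simp
      qed
      ultimately show "Y \<in> ?J" by simp
    qed
  qed
  then have "card ?J = card ?F" by (rule bij_betw_same_card)
  then show ?thesis using odd by simp
qed

text \<open>The covers of \<open>Z\<close> are the subgroups of order 4 in \<open>F\<close> and one
  join with each member of \<open>A\<close>. As there are \<open>card A + card T + 1\<close>
  subgroups of prime order, regularity at \<open>Z\<close> forces \<open>card T = card F\<close>, an
  even number equal to an odd one.\<close>

lemma no_order_four:
  assumes reg: "subgroup_graph_regular G"
    and iso: "\<And>P. P \<in> prime_subgroups (carrier G) \<Longrightarrow> odd (card P) \<Longrightarrow> isolated P"
    and w: "w \<in> carrier G" "ord w = 4"
  shows False
proof -
  let ?M = "prime_subgroups (carrier G)"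
  define z where "z = w \<otimes> w"
  have zc: "z \<in> carrier G" using w z_def by simp
  have "z = w [^] (2::nat)" using w z_def by (simp add: numeral_2_eq_2)
  then have oz: "ord z = 2" using ord_pow[OF w(1), of 2] w(2) by simp
  then have z1: "z \<noteq> \<one>" "z \<otimes> z = \<one>" using ord_eq_2_iff[OF zc] by auto
  define Z where "Z = generate G {z}"
  have Z: "Z = {\<one>, z}" unfolding Z_def by (rule generate_involution[OF zc oz])
  have ZM: "Z \<in> ?M" unfolding Z_def
    using generate_prime_subgroup[OF subgroup_self zc] oz two_is_prime_nat by simp
  note ZD = prime_subgroupsD[OF ZM]
  have cZ: "card Z = 2" using Z z1 by simp
  define A where "A = {Q \<in> ?M. odd (card Q)}"
  define T where "T = {Q \<in> ?M. card Q = 2 \<and> Q \<noteq> Z}"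
  define F where "F = {K. subgroup K G \<and> z \<in> K \<and> card K = 4}"
  have evT: "even (card T)"
    unfolding T_def Z_def by (rule even_card_other_involutions[OF zc oz])
  have oddF: "odd (card F)"
    unfolding F_def by (rule odd_card_order_four_overgroups[OF w z_def])
  have fA: "finite A" and fT: "finite T" unfolding A_def T_def using finite_prime_subgroups by auto
  have "?M = insert Z (A \<union> T)"
  proof -
    have "card Q = 2" if "Q \<in> ?M" "even (card Q)" for Q
      using prime_subgroupsD(3)[OF that(1)] that(2) primes_dvd_imp_eq two_is_prime_nat by metis
    then show ?thesis unfolding A_def T_def using ZM by auto
  qed
  moreover have "card (A \<union> T) = card A + card T"
    by (rule card_Un_disjoint[OF fA fT]) (auto simp: A_def T_def)
  moreover have "Z \<notin> A \<union> T" unfolding A_def T_def using cZ by auto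
  ultimately have cM: "card ?M = card A + card T + 1" using fA fT by simp
  have "\<exists>K. covered_by G Z K \<and> prime_subgroups K = {Z, Q}" if Q: "Q \<in> A" for Q
  proof -
    have QM: "Q \<in> ?M" "odd (card Q)" using Q unfolding A_def by auto
    have "Z \<in> ?M - {Q}" using ZM QM cZ by auto
    then have i: "card Z \<noteq> card Q" "\<forall>x\<in>Q. \<forall>y\<in>Z. x \<otimes> y = y \<otimes> x"
      using bspec[OF iso[OF QM, unfolded isolated_def]] by auto
    have "\<forall>y\<in>Z. \<forall>x\<in>Q. y \<otimes> x = x \<otimes> y" using i(2) by metis
    then show ?thesis by (rule join_commuting_prime_subgroups[OF ZM QM(1) i(1)])
  qed
  then obtain f where f: "\<And>Q. Q \<in> A \<Longrightarrow> covered_by G Z (f Q) \<and> prime_subgroups (f Q) = {Z, Q}"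
    by metis
  have inj: "inj_on f A"
  proof (rule inj_onI)
    fix Q R assume *: "Q \<in> A" "R \<in> A" "f Q = f R"
    then have "{Z, Q} = {Z, R}" using f[OF *(1)] f[OF *(2)] by simp
    moreover have "Z \<notin> A" unfolding A_def using cZ by simp
    ultimately show "Q = R" using * by (metis doubleton_eq_iff)
  qed
  have "covers Z = F \<union> f ` A"
  proof (intro equalityI subsetI)
    fix K assume K: "K \<in> F \<union> f ` A"
    show "K \<in> covers Z"
    proof (cases "K \<in> F")
      case True
      then have sK: "subgroup K G" "z \<in> K" "card K = 4" unfolding F_def by auto
      have "Z \<subseteq> K" unfolding Z_def by (rule generate_le[OF sK(1,2)])
      then have "covered_by G Z K"
        using covered_by_prime_index[OF ZD(1) sK(1) _ _ two_is_prime_nat] sK(3) cZ by simp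
      then show ?thesis unfolding covers_def by simp
    next
      case False
      then show ?thesis using K f unfolding covers_def by auto
    qed
  next
    fix K assume K: "K \<in> covers Z"
    then have cov: "covered_by G Z K" unfolding covers_def by simp
    then have sK: "subgroup K G" "Z \<subset> K" unfolding covered_by_def by auto
    show "K \<in> F \<union> f ` A"
    proof (cases "\<exists>Q\<in>A. Q \<subseteq> K")
      case True
      then obtain Q where Q: "Q \<in> A" "Q \<subseteq> K" by blast
      \<comment> \<open>Both are covers of \<open>Z\<close>, and they share \<open>Q\<close>, which
        is not inside \<open>Z\<close>.\<close>
      have "f Q = K"
      proof (rule ccontr)
        assume "f Q \<noteq> K"
        moreover have "f Q \<in> covers Z" using f[OF Q(1)] unfolding covers_def by simp
        ultimately have "f Q \<inter> K = Z" using covers_Int[OF _ K] by blast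
        moreover have "Q \<in> prime_subgroups (f Q)" using f[OF Q(1)] by simp
        then have "Q \<subseteq> f Q" by (rule prime_subgroupsD(2))
        ultimately have "Q \<subseteq> Z" using Q(2) by blast
        moreover have QM: "Q \<in> ?M" "odd (card Q)" using Q(1) unfolding A_def by auto
        ultimately have "Q = Z" using prime_subgroup_subset_eq[OF QM(1) ZM] by blast
        then show False using QM(2) cZ by simp
      qed
      then show ?thesis using Q(1) by blast
    next
      case False
      \<comment> \<open>By Cauchy, a cover without a member of \<open>A\<close> is a
        2-group.\<close>
      have two: "q = 2" if q: "prime q" "q dvd card K" for q
      proof -
        obtain R where R: "R \<in> prime_subgroups K" "card R = q"
          using exists_prime_subgroup[OF sK(1) q(2,1)] by blast
        note RD = prime_subgroupsD[OF R(1)]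
        have "R \<in> ?M" using RD unfolding prime_subgroups_def by simp
        then have "even q" using False RD(2) R(2) unfolding A_def by auto
        then show ?thesis using q(1) primes_dvd_imp_eq[OF two_is_prime_nat q(1)] by simp
      qed
      obtain k where k: "card K = 2 ^ k"
        using prime_power_if_unique_prime_divisor[OF subgroup.finite_imp_card_positive[OF sK(1) fin] two] by blast
      obtain x where x: "x \<in> K" "x \<notin> Z" "x [^] (2::nat) \<in> Z"
        using p_group_last_power[OF ZD(1) sK k] by blast
      have xc: "x \<in> carrier G" using subgroup.mem_carrier[OF sK(1) x(1)] .
      have xx: "x \<otimes> x \<in> Z" using x(3) xc by (simp add: numeral_2_eq_2)
      have zZ: "z \<in> Z" using Z by simp
      \<comment> \<open>\<open>Z\<close> is normal in \<open>K\<close>, and a conjugate of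
        \<open>z\<close> is nontrivial, so \<open>x\<close> centralizes \<open>z\<close>; the
        subgroup of order 4 formed from \<open>x\<close> and \<open>z\<close> lies strictly above
        \<open>Z\<close> and within \<open>K\<close>, hence is \<open>K\<close>.\<close>
      have "x \<otimes> z \<otimes> inv x \<in> Z"
        using p_group_cover_normal[OF cov k two_is_prime_nat] x(1) zZ by blast
      moreover have "x \<otimes> z \<otimes> inv x \<noteq> \<one>"
        using ord_conj[OF xc zc] oz by auto
      ultimately have "x \<otimes> z \<otimes> inv x = z" using Z by simp
      then have xz: "x \<otimes> z = z \<otimes> x" using xc zc by (metis inv_solve_right m_closed)
      have L: "subgroup {\<one>, z, x, z \<otimes> x} G" "card {\<one>, z, x, z \<otimes> x} = 4"
        using four_group[OF zc z1 xc _ xz] x(2) xx unfolding Z by auto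
      have zK: "z \<in> K" using zZ sK(2) by blast
      have "{\<one>, z, x, z \<otimes> x} \<subseteq> K"
        using subgroup.one_closed[OF sK(1)] zK x(1) subgroup.m_closed[OF sK(1)] by simp
      moreover have "Z \<subset> {\<one>, z, x, z \<otimes> x}" using x(2) unfolding Z by auto
      ultimately have "{\<one>, z, x, z \<otimes> x} = K" using cov L(1) unfolding covered_by_def by blast
      then have "K \<in> F" unfolding F_def using L(2) sK(1) zK by simp
      then show ?thesis by simp
    qed
  qed
  moreover have "F \<inter> f ` A = {}"
  proof -
    have "f Q \<notin> F" if Q: "Q \<in> A" for Q
    proof
      assume "f Q \<in> F"
      then have "subgroup (f Q) G" "card (f Q) = 4" unfolding F_def by auto
      moreover have "Q \<in> prime_subgroups (f Q)" using f[OF Q] by simp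
      note D = prime_subgroupsD[OF this]
      ultimately have "card Q dvd 2 ^ 2" using card_subgroup_dvd[OF D(1) _ D(2)] by simp
      then have "card Q dvd 2" using D(3) prime_dvd_power by blast
      then have "card Q = 2" using primes_dvd_imp_eq[OF D(3) two_is_prime_nat] by simp
      then show False using Q unfolding A_def by simp
    qed
    then show ?thesis by blast
  qed
  moreover have "finite F"
    by (rule finite_subset[of _ "Pow (carrier G)"]) (auto simp: F_def fin dest: subgroup.subset)
  ultimately have "card (covers Z) = card F + card A"
    using fA by (simp add: card_Un_disjoint card_image[OF inj])
  then have "card T = card F" using card_covers_prime[OF reg ZM] cM by simp
  then show False using evT oddF by simp
qed

section \<open>Cyclic groups of square-free order\<close>

text \<open>Induction on the order. In \<open>ord x = p * m\<close> the prime \<open>p\<close> does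
  not divide \<open>m\<close>, since order \<open>p * p\<close> is excluded; so \<open>x\<close> is
  a product of powers of \<open>x [^] m\<close>, of order \<open>p\<close>, and
  \<open>x [^] p\<close>, of smaller order \<open>m\<close>.\<close>

lemma subgroup_containing_prime_elements:
  assumes nosq: "\<And>x p. x \<in> carrier G \<Longrightarrow> prime p \<Longrightarrow> ord x \<noteq> p * p"
    and H: "subgroup H G" "\<And>x. x \<in> carrier G \<Longrightarrow> prime (ord x) \<Longrightarrow> x \<in> H"
    and x: "x \<in> carrier G"
  shows "x \<in> H"
  using x
proof (induction "ord x" arbitrary: x rule: less_induct)
  case less
  note x = \<open>x \<in> carrier G\<close>
  show ?case
  proof (cases "x = \<one>")
    case True
    then show ?thesis using subgroup.one_closed[OF H(1)] by simp
  next
    case False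
    then have "ord x \<noteq> 1" using ord_eq_1[OF x] by simp
    then obtain p where p: "prime p" "p dvd ord x" using prime_factor_nat by blast
    then obtain m where m: "ord x = p * m" by auto
    have m0: "0 < m" "0 < p" using m ord_pos[OF x] by auto
    have "\<not> p dvd m"
    proof
      assume "p dvd m"
      then have "p * p dvd ord x" using m by simp
      then show False using pow_ord_div[OF x] nosq[OF _ p(1)] x by blast
    qed
    then have cop: "coprime p m" using prime_imp_coprime[OF p(1)] by simp
    have "ord (x [^] m) = p" using ord_pow[OF x, of m] m m0 by simp
    then have 1: "x [^] m \<in> H" using H(2) p(1) x by simp
    have "ord (x [^] p) = m" using ord_pow[OF x, of p] m m0 by simp
    moreover have "m < ord x" using m m0 prime_gt_1_nat[OF p(1)] by simp
    ultimately have 2: "x [^] p \<in> H" using less.hyps[of "x [^] p"] x by simp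
    obtain a where a: "[m * a = 1] (mod p)" using cong_solve_coprime_nat[of m p] cop by (auto simp: coprime_commute)
    obtain b where b: "[p * b = 1] (mod m)" using cong_solve_coprime_nat[of p m] cop by auto
    \<comment> \<open>Bezout within the naturals: \<open>a\<close> and \<open>b\<close> are inverses
      modulo the opposite factors, and the two congruences combine modulo
      \<open>p * m\<close>.\<close>
    have "[m * a + p * b = 1 + 0] (mod p)" using a by (intro cong_add) (simp_all add: cong_0_iff)
    moreover have "[m * a + p * b = 0 + 1] (mod m)" using b by (intro cong_add) (simp_all add: cong_0_iff)
    ultimately have "[m * a + p * b = 1] (mod (p * m))"
      using coprime_cong_mult_nat cop by simp
    then have "x [^] (m * a + p * b) = x [^] (1::nat)" using pow_eq_pow_iff_cong[OF x] m by metis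
    then have "x = (x [^] m) [^] a \<otimes> (x [^] p) [^] b"
      using x by (simp add: nat_pow_pow nat_pow_mult)
    moreover have "(x [^] m) [^] a \<in> H" "(x [^] p) [^] b \<in> H" using subgroup_pow_closed[OF H(1)] 1 2 by auto
    ultimately show ?thesis using subgroup.m_closed[OF H(1)] by metis
  qed
qed

lemma ord_mult_coprime:
  assumes x: "x \<in> carrier G" and y: "y \<in> carrier G" and xy: "x \<otimes> y = y \<otimes> x"
    and cop: "coprime (ord x) (ord y)"
  shows "ord (x \<otimes> y) = ord x * ord y"
proof (rule dvd_antisym)
  show "ord (x \<otimes> y) dvd ord x * ord y" by (rule ord_mul_divides[OF xy x y])
  let ?n = "ord (x \<otimes> y)"
  have 1: "(x \<otimes> y) [^] (?n * k) = \<one>" for k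
    using pow_eq_id[of "x \<otimes> y" "?n * k"] x y by simp
  have "x [^] (?n * ord y) \<otimes> y [^] (?n * ord y) = \<one>"
    using pow_mult_distrib[OF xy x y] 1 by metis
  moreover have "y [^] (?n * ord y) = \<one>" using pow_eq_id[OF y] by simp
  ultimately have "ord x dvd ?n * ord y" using pow_eq_id[OF x] x by simp
  then have a: "ord x dvd ?n" using cop coprime_dvd_mult_left_iff by blast
  have "x [^] (?n * ord x) \<otimes> y [^] (?n * ord x) = \<one>"
    using pow_mult_distrib[OF xy x y] 1 by metis
  moreover have "x [^] (?n * ord x) = \<one>" using pow_eq_id[OF x] by simp
  ultimately have "ord y dvd ?n * ord x" using pow_eq_id[OF y] y by simp
  then have b: "ord y dvd ?n" using cop coprime_dvd_mult_left_iff coprime_commute by blast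
  show "ord x * ord y dvd ?n" using a b cop by (rule divides_mult)
qed

text \<open>Elements of prime order commute with each other. A subgroup containing all of them is
  everything; this is applied to the centralizer of one of them, then to the centre, and last to the
  group generated by an element \<open>g\<close> of maximal order.\<close>

lemma cyclic_squarefree_if_isolated:
  assumes iso: "\<And>P. P \<in> prime_subgroups (carrier G) \<Longrightarrow> isolated P"
    and nosq: "\<And>x p. x \<in> carrier G \<Longrightarrow> prime p \<Longrightarrow> ord x \<noteq> p * p"
  shows "cyclic_group G \<and> squarefree (order G)"
proof -
  let ?M = "prime_subgroups (carrier G)"
  have gM: "generate G {x} \<in> ?M" if "x \<in> carrier G" "prime (ord x)" for x
    using generate_prime_subgroup[OF subgroup_self that] .
  have same: "generate G {x} = generate G {y}"
    if "x \<in> carrier G" "y \<in> carrier G" "prime (ord x)" "ord x = ord y" for x y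
  proof (rule ccontr)
    assume ne: "generate G {x} \<noteq> generate G {y}"
    have "generate G {x} \<in> ?M - {generate G {y}}" using ne gM that by auto
    moreover have "isolated (generate G {y})" using iso gM that by simp
    ultimately have "card (generate G {x}) \<noteq> card (generate G {y})" unfolding isolated_def by blast
    then show False using that card_generate by simp
  qed
  have prime_comm: "x \<otimes> y = y \<otimes> x"
    if x: "x \<in> carrier G" "prime (ord x)" and y: "y \<in> carrier G" "prime (ord y)" for x y
  proof (cases "generate G {x} = generate G {y}")
    case True
    then have "x \<in> generate G {y}" using generate_self[of x] by simp
    then obtain k :: nat where k: "x = y [^] k" using generateE[OF _ y(1)] by blast
    then show ?thesis using nat_pow_Suc2[OF y(1), of k] by simp
  next
    case False
    then have "generate G {y} \<in> ?M - {generate G {x}}" using gM y by auto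
    moreover have "isolated (generate G {x})" using iso gM x by simp
    ultimately have "\<forall>a\<in>generate G {x}. \<forall>b\<in>generate G {y}. a \<otimes> b = b \<otimes> a" unfolding isolated_def by blast
    then show ?thesis using generate_self by blast
  qed
  have central: "x \<otimes> y = y \<otimes> x" if x: "x \<in> carrier G" and y: "y \<in> carrier G" "prime (ord y)" for x y
  proof -
    have s: "subgroup {u \<in> carrier G. \<forall>a\<in>{y}. u \<otimes> a = a \<otimes> u} G" using centralizer_subgroup[of "{y}"] y by simp
    have "x \<in> {u \<in> carrier G. \<forall>a\<in>{y}. u \<otimes> a = a \<otimes> u}"
      by (rule subgroup_containing_prime_elements[OF nosq s _ x]) (use prime_comm y in auto)
    then show ?thesis by simp
  qed
  have comm: "x \<otimes> y = y \<otimes> x" if x: "x \<in> carrier G" and y: "y \<in> carrier G" for x y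
  proof -
    have s: "subgroup {u \<in> carrier G. \<forall>a\<in>carrier G. u \<otimes> a = a \<otimes> u} G" using centralizer_subgroup[of "carrier G"] by simp
    have "x \<in> {u \<in> carrier G. \<forall>a\<in>carrier G. u \<otimes> a = a \<otimes> u}"
      by (rule subgroup_containing_prime_elements[OF nosq s _ x]) (use central in auto)
    then show ?thesis using y by simp
  qed
  have "Max (ord ` carrier G) \<in> ord ` carrier G" by (rule Max_in) (use fin one_closed in blast)+
  then obtain g where g: "g \<in> carrier G" "ord g = Max (ord ` carrier G)" by (rule imageE) simp
  have gmax: "ord x \<le> ord g" if "x \<in> carrier G" for x
    unfolding g(2) by (rule Max_ge) (use fin that in auto)
  have sg: "subgroup (generate G {g}) G" by (rule subgroup_generate[OF g(1)])
  have "y \<in> generate G {g}" if y: "y \<in> carrier G" "prime (ord y)" for y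
  proof (cases "ord y dvd ord g")
    case True
    \<comment> \<open>Isolation leaves a single subgroup of order \<open>ord y\<close>, and a power
      of \<open>g\<close> generates one.\<close>
    let ?h = "g [^] (ord g div ord y)"
    have "ord ?h = ord y" by (rule pow_ord_div[OF g(1) True])
    then have "generate G {y} = generate G {?h}" using same[of y ?h] y g(1) by simp
    moreover have "?h \<in> generate G {g}" using subgroup_pow_closed[OF sg generate_self] .
    then have "generate G {?h} \<subseteq> generate G {g}" by (rule generate_le[OF sg])
    ultimately show ?thesis using generate_self[of y] by auto
  next
    case False
    then have "coprime (ord g) (ord y)" using prime_imp_coprime[OF y(2)] by (simp add: coprime_commute)
    \<comment> \<open>A prime order not dividing \<open>ord g\<close> would give an element of
      larger order than \<open>g\<close>.\<close>
    then have "ord (g \<otimes> y) = ord g * ord y" using ord_mult_coprime[OF g(1) y(1) comm[OF g(1) y(1)]] by simp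
    moreover have "ord g < ord g * ord y" using ord_pos[OF g(1)] prime_gt_1_nat[OF y(2)] by simp
    ultimately show ?thesis using gmax[of "g \<otimes> y"] g(1) y(1) by simp
  qed
  then have "carrier G \<subseteq> generate G {g}" using subgroup_containing_prime_elements[OF nosq sg] by blast
  then have cg: "carrier G = generate G {g}" using subgroup.subset[OF sg] by blast
  have "carrier G = range (\<lambda>n::int. g [^] n)" unfolding cg using generate_pow[OF g(1)] by auto
  then have "cyclic_group G" using cyclic_group g(1) by blast
  moreover have "order G = ord g" unfolding order_def using cg card_generate[OF g(1)] by simp
  moreover have "squarefree (ord g)"
  proof (rule squarefreeI)
    fix d assume d: "d\<^sup>2 dvd ord g"
    show "is_unit d"
    proof (rule ccontr)
      assume "\<not> is_unit d"
      then obtain p where p: "prime p" "p dvd d" using prime_factor_nat[of d] by auto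
      then have "p * p dvd d * d" by (intro mult_dvd_mono)
      then have "p * p dvd ord g" using d by (auto simp: power2_eq_square)
      then show False using pow_ord_div[OF g(1)] nosq[OF _ p(1)] g(1) by blast
    qed
  qed
  ultimately show ?thesis by simp
qed

section \<open>The two implications\<close>

text \<open>Odd primes come first, because excluding elements of order 4 relies on the isolation of
  all subgroups of odd prime order.\<close>

lemma regular_imp_cyclic_squarefree:
  assumes reg: "subgroup_graph_regular G"
  shows "cyclic_group G \<and> squarefree (order G)"
proof (rule cyclic_squarefree_if_isolated)
  have iso_odd: "isolated P" if P: "P \<in> prime_subgroups (carrier G)" "odd (card P)" for P
    using isolated_if_no_prime_square[OF reg P(1)]
      no_odd_prime_square[OF reg prime_subgroupsD(3)[OF P(1)] P(2)] by blast
  show nosq: "ord x \<noteq> p * p" if x: "x \<in> carrier G" and p: "prime p" for x p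
  proof
    assume o: "ord x = p * p"
    show False
    proof (cases "odd p")
      case True
      then show False using no_odd_prime_square[OF reg p _ x o] by blast
    next
      case False
      then have "p = 2" using p primes_dvd_imp_eq two_is_prime_nat by blast
      then show False using no_order_four[OF reg iso_odd x] o by simp
    qed
  qed
  show "isolated P" if P: "P \<in> prime_subgroups (carrier G)" for P
    using isolated_if_no_prime_square[OF reg P] nosq prime_subgroupsD(3)[OF P] by blast
qed

text \<open>Subgroups correspond to the divisors of \<open>n\<close>, and a covering means a prime
  quotient of orders. Since \<open>n\<close> is square-free, each prime factor of \<open>n\<close>
  gives exactly one neighbour, so every degree is the number of prime factors.\<close>

lemma cyclic_squarefree_imp_regular:
  assumes cyc: "cyclic_group G" and sqf: "squarefree (order G)"
  shows "subgroup_graph_regular G"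
proof -
  obtain g where g: "g \<in> carrier G" "carrier G = range (\<lambda>n::int. g [^] n)" using cyc cyclic_group by blast
  have cg: "carrier G = generate G {g}" using g(2) generate_pow[OF g(1)] by auto
  define n where "n = ord g"
  have n: "order G = n" unfolding n_def order_def using cg card_generate[OF g(1)] by simp
  have n0: "0 < n" unfolding n_def by (rule ord_pos[OF g(1)])
  \<comment> \<open>Meaningful for divisors \<open>d\<close> of \<open>n\<close>, where it is the
    subgroup of order \<open>d\<close>.\<close>
  define S where "S d = generate G {g [^] (n div d)}" for d
  have sS: "subgroup (S d) G" for d unfolding S_def by (simp add: subgroup_generate g(1))
  have cS: "card (S d) = d" if "d dvd n" for d
    unfolding S_def using card_generate pow_ord_div[OF g(1)] that g(1) unfolding n_def by simp
  have HS: "H = S (card H)" if H: "subgroup H G" for H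
    unfolding S_def n_def by (rule subgroup_of_cyclic[OF g(1) H]) (use subgroup.subset[OF H] cg in simp)
  have dn: "card H dvd n" if "subgroup H G" for H
    using card_subgroup_dvd[OF that subgroup_self subgroup.subset[OF that]] n by (simp add: order_def)
  have mono: "S a \<subseteq> S b" if ab: "a dvd b" "b dvd n" for a b
  proof -
    obtain c where c: "b = a * c" using ab by auto
    obtain d where d: "n = b * d" using ab by auto
    have pos: "0 < a" "0 < b" "0 < c" using c d n0 by auto
    have "n div a = n div b * c" using c d pos by simp
    then have "g [^] (n div a) = (g [^] (n div b)) [^] c" using g(1) by (simp add: nat_pow_pow)
    then have "g [^] (n div a) \<in> S b" using subgroup_pow_closed[OF sS[of b]] generate_self unfolding S_def by simp
    then show ?thesis using generate_le[OF sS] unfolding S_def[of a] by blast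
  qed
  have cov: "covered_by G H K \<longleftrightarrow> (\<exists>p. prime p \<and> card K = card H * p)"
    if H: "subgroup H G" and K: "subgroup K G" for H K
  proof
    assume "\<exists>p. prime p \<and> card K = card H * p"
    then obtain p where p: "prime p" "card K = card H * p" by blast
    have "S (card H) \<subseteq> S (card K)" by (rule mono) (use p dn[OF K] in auto)
    then have "H \<subseteq> K" using HS[OF H] HS[OF K] by simp
    then show "covered_by G H K" using covered_by_prime_index[OF H K _ p(2,1)] by simp
  next
    assume c: "covered_by G H K"
    then have HK: "H \<subset> K" unfolding covered_by_def by blast
    then obtain a where a: "card K = card H * a" using card_subgroup_dvd[OF H K] by auto
    have "a \<noteq> 1" using a subgroup_card_eq[OF H K] HK by auto
    then obtain p where p: "prime p" "p dvd a" using prime_factor_nat by blast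
    have d: "card H * p dvd card K" using a p(2) by simp
    have dN: "card H * p dvd n" using d dn[OF K] by (rule dvd_trans)
    let ?L = "S (card H * p)"
    have cL: "card ?L = card H * p" by (rule cS[OF dN])
    have "S (card H) \<subseteq> ?L" by (rule mono[OF _ dN]) simp
    then have HL: "H \<subseteq> ?L" using HS[OF H] by simp
    have "?L \<subseteq> S (card K)" by (rule mono[OF d dn[OF K]])
    then have LK: "?L \<subseteq> K" using HS[OF K] by simp
    have "0 < card H" using subgroup.finite_imp_card_positive[OF H fin] .
    then have "card ?L \<noteq> card H" using cL prime_gt_1_nat[OF p(1)] by simp
    then have "H \<subset> ?L" using HL by auto
    then have "?L = K" using c sS LK unfolding covered_by_def by blast
    then show "\<exists>p. prime p \<and> card K = card H * p" using cL p(1) by auto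
  qed
  have "subgroup_graph_degree G H = card (prime_factors n)" if H: "subgroup H G" for H
  proof -
    let ?m = "card H"
    let ?N = "{K \<in> subgroups_of G. subgroup_graph_adj G H K}"
    have m: "?m dvd n" "0 < ?m" using dn[OF H] subgroup.finite_imp_card_positive[OF H fin] by auto
    \<comment> \<open>The order of the neighbour that belongs to the prime \<open>p\<close>:
      toggling \<open>p\<close> leads down or up.\<close>
    define h where "h p = (if p dvd ?m then ?m div p else ?m * p)" for p
    have hn: "h p dvd n" if p: "p \<in> prime_factors n" for p
    proof (cases "p dvd ?m")
      case True
      then have "h p dvd ?m" unfolding h_def by (auto elim!: dvdE)
      then show ?thesis using m(1) dvd_trans by blast
    next
      case False
      have pp: "prime p" "p dvd n" using p by auto
      then have "coprime ?m p" using prime_imp_coprime[OF pp(1) False] by (simp add: coprime_commute)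
      then show ?thesis unfolding h_def using False m(1) pp(2) by (simp add: divides_mult)
    qed
    have "bij_betw (\<lambda>p. S (h p)) (prime_factors n) ?N"
      unfolding bij_betw_def
    proof
      show "inj_on (\<lambda>p. S (h p)) (prime_factors n)"
      proof (rule inj_onI)
        fix p q assume p: "p \<in> prime_factors n" and q: "q \<in> prime_factors n" and e: "S (h p) = S (h q)"
        have pq: "1 < p" "1 < q" using p q prime_gt_1_nat by auto
        have "card (S (h p)) = card (S (h q))" by (rule arg_cong[OF e])
        then have hh: "h p = h q" by (simp only: cS[OF hn[OF p]] cS[OF hn[OF q]])
        \<comment> \<open>Rules out that one prime leads down and another leads up to the same
          order.\<close>
        have mix: False if ab: "a dvd ?m" "1 < a" "1 < b" "?m div a = ?m * b" for a b
        proof -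
          have "?m = ?m * b * a" using ab(1,4) by (metis dvd_div_mult_self)
          then have "b * a = 1" using m(2) by simp
          then show False using ab(2,3) by simp
        qed
        show "p = q"
        proof (cases "p dvd ?m"; cases "q dvd ?m")
          assume d: "p dvd ?m" "q dvd ?m"
          then have "?m div p = ?m div q" using hh unfolding h_def by simp
          moreover have "?m = p * (?m div p)" "?m = q * (?m div q)" using d by simp_all
          ultimately show ?thesis using m(2) by (metis mult_cancel2 neq0_conv mult_0_right)
        next
          assume "p dvd ?m" "\<not> q dvd ?m"
          then show ?thesis using mix[of p q] hh pq unfolding h_def by simp
        next
          assume "\<not> p dvd ?m" "q dvd ?m"
          then show ?thesis using mix[of q p] hh pq unfolding h_def by simp
        next
          assume "\<not> p dvd ?m" "\<not> q dvd ?m"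
          then show ?thesis using hh m(2) unfolding h_def by simp
        qed
      qed
      show "(\<lambda>p. S (h p)) ` prime_factors n = ?N"
      proof (intro equalityI subsetI)
        fix K assume "K \<in> (\<lambda>p. S (h p)) ` prime_factors n"
        then obtain p where p: "p \<in> prime_factors n" "K = S (h p)" by auto
        have sK: "subgroup K G" "card K = h p" using p sS cS[OF hn[OF p(1)]] by auto
        have pp: "prime p" using p(1) by auto
        have "card K * p = ?m \<or> ?m * p = card K" unfolding sK(2) h_def by auto
        then have "covered_by G H K \<or> covered_by G K H" using cov[OF H sK(1)] cov[OF sK(1) H] pp by metis
        then show "K \<in> ?N" using sK(1) unfolding subgroups_of_def subgroup_graph_adj_def by simp
      next
        fix K assume "K \<in> ?N"
        then have sK: "subgroup K G" and adj: "covered_by G H K \<or> covered_by G K H"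
          unfolding subgroups_of_def subgroup_graph_adj_def by auto
        from adj obtain p where p: "prime p" "card K = ?m * p \<or> ?m = card K * p"
          using cov[OF H sK] cov[OF sK H] by blast
        have "p dvd n" using p(2) dn[OF sK] m(1) by (metis dvd_mult_right dvd_trans)
        then have pf: "p \<in> prime_factors n" using p(1) n0 by (simp add: prime_factors_dvd)
        have "h p = card K"
        proof (cases "p dvd ?m")
          case True
          \<comment> \<open>Square-freeness is used here: adjoining \<open>p\<close> a second time
            would make \<open>p * p\<close> divide \<open>n\<close>.\<close>
          have "card K \<noteq> ?m * p"
          proof
            assume "card K = ?m * p"
            then have "p * p dvd card K" using True by simp
            then have "p * p dvd n" using dn[OF sK] dvd_trans by blast
            then have "is_unit p" using sqf n unfolding squarefree_def by (simp add: power2_eq_square)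
            then show False using p(1) by auto
          qed
          then have "?m = card K * p" using p(2) by simp
          then show ?thesis using True prime_gt_0_nat[OF p(1)] unfolding h_def by simp
        next
          case False
          then have "card K = ?m * p" using p(2) by auto
          then show ?thesis using False unfolding h_def by simp
        qed
        then have "K = S (h p)" using HS[OF sK] by simp
        then show "K \<in> (\<lambda>p. S (h p)) ` prime_factors n" using pf by blast
      qed
    qed
    then show ?thesis unfolding subgroup_graph_degree_def by (metis bij_betw_same_card)
  qed
  then show ?thesis unfolding subgroup_graph_regular_def subgroups_of_def by simp
qed

end

theorem mainTheorem1:
  fixes G :: "('a, 'b) monoid_scheme"
  assumes "group G" and "finite (carrier G)"
  shows "subgroup_graph_regular G \<longleftrightarrow> cyclic_group G \<and> squarefree (order G)"
proof -
  interpret finite_group G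
    using assms by (simp add: finite_group_def finite_group_axioms_def)
  show ?thesis using regular_imp_cyclic_squarefree cyclic_squarefree_imp_regular by blast
qed

end
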